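(* Let $(A,h,\delta)$ be an AsGDer triple with multiplication $\mu$, and let $H^n_{\mathrm{AsGDer}}(A,A)$ be its $n$-th AsGDer cohomology group. (i) Let $\mu_1\colon A^{\otimes2}\to A$ and $h_1,\delta_1\colon A\to A$ be linear maps. Then $(\mu_1,h_1,\delta_1)$ is an infinitesimal deformation of $(A,h,\delta)$ if and only if $(\mu_1,h_1,\delta_1)$ is a $2$-cocycle in the AsGDer complex of $(A,h,\delta)$. In particular, if $H^2_{\mathrm{AsGDer}}(A,A)=0$, then $(A,h,\delta)$ has no nontrivial formal deformation. (ii) Let $n\ge2$ and let $\mu_k\colon A^{\otimes2}\to A$, $h_k,\delta_k\colon A\to A$ ($1\le k\le n-1$) be linear maps such that the deformation equations $(\mathrm{DE}_k\text{-}1)$, $(\mathrm{DE}_k\text{-}2)$, $(\mathrm{DE}_k\text{-}3)$ hold for $k=1,\dots,n-1$. Then $(\mathrm{Ob}'_n,\mathrm{Ob}''_n,\mathrm{Ob}'''_n)$ is a $3$-cocycle in the AsGDer complex, and hence its class in $H^3_{\mathrm{AsGDer}}(A,A)$ is the obstruction to finding $(\mu_n,h_n,\delta_n)$ satisfying $(\mathrm{DE}_n\text{-}1)$, $(\mathrm{DE}_n\text{-}2)$, $(\mathrm{DE}_n\text{-}3)$ (such a triple exists if and only if the class is zero). In particular, if $H^3_{\mathrm{AsGDer}}(A,A)=0$, then all the obstructions vanish.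
   Context: $\Bbbk$ is a field of characteristic zero. An AsGDer triple $(A,h,\delta)$ is a (not necessarily unital) associative $\Bbbk$-algebra $A$ with a derivation $h$ and a linear map $\delta\colon A\to A$ satisfying $\delta(ab)=\delta(a)b+ah(b)$ for all $a,b\in A$. The same definition applies over $\Bbbk[[t]]$ or $\Bbbk[t]/(t^2)$. For $f$ of arity $k$, $f\circ_ig=f\circ(\mathrm{Id}^{\otimes i-1}\otimes g\otimes\mathrm{Id}^{\otimes k-i})$. AsGDer complex: $C^n_{\mathrm{AsGDer}}(A,A)=0$ for $n\le0$; $C^1_{\mathrm{AsGDer}}(A,A)=\mathrm{Hom}(A,A)$; $C^n_{\mathrm{AsGDer}}(A,A)=\mathrm{Hom}(A^{\otimes n},A)\oplus\mathrm{Hom}(A^{\otimes n-1},A)\oplus\mathrm{Hom}(A^{\otimes n-1},A)$ for $n\ge2$. The differential is, for $f\in C^1$, $$\partial(f)=(\mu\circ_1f+\mu\circ_2f-f\circ_1\mu,\ h\circ_1f-f\circ_1h,\ \delta\circ_1f-f\circ_1\delta),$$ and for $f=(f_1,f_2,f_3)\in C^n$, $n\ge2$, $\partial(f)=(g_1,g_2,g_3)$ with $$g_1=\mu\circ_2f_1+\sum_{i=1}^n(-1)^if_1\circ_i\mu+(-1)^{n+1}\mu\circ_1f_1,$$ $$g_2=\mu\circ_2f_2+(-1)^n\mu\circ_1f_2+\sum_{i=1}^{n-1}(-1)^if_2\circ_i\mu+(-1)^{n-1}\Big(h\circ_1f_1-\sum_{i=1}^nf_1\circ_ih\Big),$$ $$g_3=\mu\circ_2f_2+(-1)^n\mu\circ_1f_3+\sum_{i=1}^{n-1}(-1)^if_3\circ_i\mu+(-1)^{n-1}\Big(\delta\circ_1f_1-f_1\circ_1\delta-\sum_{i=2}^nf_1\circ_ih\Big).$$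 $H^n_{\mathrm{AsGDer}}(A,A)$ is the $n$-th cohomology of this complex. A formal deformation of $(A,h,\delta)$ is an AsGDer triple $(A[[t]],h_t,\delta_t)$ over $\Bbbk[[t]]$ whose multiplication, derivation and generalized derivation have the form $\mu_t=\sum_{i\ge0}\mu_it^i$, $h_t=\sum_{i\ge0}h_it^i$, $\delta_t=\sum_{i\ge0}\delta_it^i$, with $\mu_i\in\mathrm{Hom}(A^{\otimes2},A)$, $h_i,\delta_i\in\mathrm{Hom}(A,A)$ and $\mu_0=\mu$, $h_0=h$, $\delta_0=\delta$. It is trivial if it is isomorphic to the constant deformation $(\mu,h,\delta)$ by a $\Bbbk[[t]]$-linear isomorphism of AsGDer triples of the form $\mathrm{Id}+\sum_{i\ge1}\varphi_it^i$, $\varphi_i\in\mathrm{Hom}(A,A)$. A triple $(\mu_1,h_1,\delta_1)$ is an infinitesimal deformation if $\mu+\mu_1t$, $h+h_1t$, $\delta+\delta_1t$ define an AsGDer triple structure on $A[[t]]/(t^2)$. Obstruction cochains ($a,b,c\in A$): $$\mathrm{Ob}'_n(a,b,c)=\sum_{i+j=n,\ i,j>0}\big(\mu_i(\mu_j(a,b),c)-\mu_i(a,\mu_j(b,c))\big),$$ $$\mathrm{Ob}''_n(a,b)=\sum_{i+j=n,\ i,j>0}\big(h_i(\mu_j(a,b))-\mu_i(h_j(a),b)-\mu_i(a,h_j(b))\big),$$ $$\mathrm{Ob}'''_n(a,b)=\sum_{i+j=n,\ i,j>0}\big(\delta_i(\mu_j(a,b))-\mu_i(\delta_j(a),b)-\mu_i(a,h_j(b))\big).$$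 Deformation equations (for all $a,b,c\in A$): $(\mathrm{DE}_n\text{-}1)$: $\mathrm{Ob}'_n(a,b,c)=a\mu_n(b,c)-\mu_n(ab,c)+\mu_n(a,bc)-\mu_n(a,b)c$; $(\mathrm{DE}_n\text{-}2)$: $\mathrm{Ob}''_n(a,b)=\mu_n(a,h(b))+\mu_n(h(a),b)-h(\mu_n(a,b))+h_n(a)b+ah_n(b)-h_n(ab)$; $(\mathrm{DE}_n\text{-}3)$: $\mathrm{Ob}'''_n(a,b)=\mu_n(\delta(a),b)+\mu_n(a,h(b))-\delta(\mu_n(a,b))+\delta_n(a)b+ah_n(b)-\delta_n(ab)$. *)

theory Defs
  imports
    "HOL-Algebra.Elementary_Groups"
    "HOL-Computational_Algebra.Formal_Power_Series"
    "HOL-Library.Function_Algebras"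
    "HOL-Library.Product_Plus"
begin

section \<open>AsGDer triples over a commutative ring\<close>

definition bilin :: "('r::comm_ring_1 \<Rightarrow> 'm::ab_group_add \<Rightarrow> 'm) \<Rightarrow> ('m \<Rightarrow> 'm \<Rightarrow> 'm) \<Rightarrow> bool" where
  "bilin scale m \<longleftrightarrow>
     (\<forall>a. module_hom scale scale (\<lambda>b. m a b)) \<and> (\<forall>b. module_hom scale scale (\<lambda>a. m a b))"

text \<open>
  The module is a whole type, with its scalar multiplication and its (not necessarily unital)
  associative product as parameters, so that the same notion can be used over the ground field,
  over the power series ring and over the dual numbers.
\<close>

locale asgder_triple = Modules.module scale
  for scale :: "'r::comm_ring_1 \<Rightarrow> 'm::ab_group_add \<Rightarrow> 'm" +
  fixes \<mu> :: "'m \<Rightarrow> 'm \<Rightarrow> 'm" and h :: "'m \<Rightarrow> 'm" and \<delta> :: "'m \<Rightarrow> 'm"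
  assumes mult_bilin: "bilin scale \<mu>"
    and mult_assoc: "\<mu> (\<mu> a b) c = \<mu> a (\<mu> b c)"
    and der_linear: "module_hom scale scale h"
    and der: "h (\<mu> a b) = \<mu> (h a) b + \<mu> a (h b)"
    and gder_linear: "module_hom scale scale \<delta>"
    and gder: "\<delta> (\<mu> a b) = \<mu> (\<delta> a) b + \<mu> a (h b)"

definition asgder_iso ::
  "('r::comm_ring_1 \<Rightarrow> 'm::ab_group_add \<Rightarrow> 'm) \<Rightarrow>
   ('m \<Rightarrow> 'm \<Rightarrow> 'm) \<Rightarrow> ('m \<Rightarrow> 'm) \<Rightarrow> ('m \<Rightarrow> 'm) \<Rightarrow>
   ('m \<Rightarrow> 'm \<Rightarrow> 'm) \<Rightarrow> ('m \<Rightarrow> 'm) \<Rightarrow> ('m \<Rightarrow> 'm) \<Rightarrow> ('m \<Rightarrow> 'm) \<Rightarrow> bool" where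
  "asgder_iso scale \<mu> h \<delta> \<mu>' h' \<delta>' \<Phi> \<longleftrightarrow>
     module_hom scale scale \<Phi> \<and> bij \<Phi> \<and>
     (\<forall>x y. \<Phi> (\<mu> x y) = \<mu>' (\<Phi> x) (\<Phi> y)) \<and>
     (\<forall>x. \<Phi> (h x) = h' (\<Phi> x)) \<and> (\<forall>x. \<Phi> (\<delta> x) = \<delta>' (\<Phi> x))"


section \<open>The AsGDer complex\<close>

text \<open>
  An \<open>n\<close>-ary operation is a function on lists that vanishes on lists of length other than \<open>n\<close>;
  this junk value makes the representation of a multilinear map unique.
\<close>

fun nary1 :: "('a \<Rightarrow> 'a) \<Rightarrow> 'a list \<Rightarrow> 'a::zero" where
  "nary1 f [a] = f a"
| "nary1 f _ = 0"

fun nary2 :: "('a \<Rightarrow> 'a \<Rightarrow> 'a) \<Rightarrow> 'a list \<Rightarrow> 'a::zero" where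
  "nary2 f [a, b] = f a b"
| "nary2 f _ = 0"

fun nary3 :: "('a \<Rightarrow> 'a \<Rightarrow> 'a \<Rightarrow> 'a) \<Rightarrow> 'a list \<Rightarrow> 'a::zero" where
  "nary3 f [a, b, c] = f a b c"
| "nary3 f _ = 0"

definition Hom :: "('k::comm_ring_1 \<Rightarrow> 'a::ab_group_add \<Rightarrow> 'a) \<Rightarrow> nat \<Rightarrow> ('a list \<Rightarrow> 'a) set" where
  "Hom scale n = {f.
     (\<forall>xs. length xs \<noteq> n \<longrightarrow> f xs = 0) \<and>
     (\<forall>xs. length xs = n \<longrightarrow> (\<forall>i<n. module_hom scale scale (\<lambda>x. f (xs[i := x]))))}"

text \<open>
  \<open>comp_at i l f g\<close> is the partial composition of \<open>g\<close> into the \<open>i\<close>-th input of \<open>f\<close> (counted from 1),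
  where \<open>l\<close> is the arity of \<open>g\<close>.
\<close>

definition comp_at ::
  "nat \<Rightarrow> nat \<Rightarrow> ('a list \<Rightarrow> 'a) \<Rightarrow> ('a list \<Rightarrow> 'a) \<Rightarrow> 'a list \<Rightarrow> 'a" where
  "comp_at i l f g xs =
     f (take (i - 1) xs @ g (take l (drop (i - 1) xs)) # drop (i - 1 + l) xs)"

type_synonym 'a cochain = "('a list \<Rightarrow> 'a) \<times> ('a list \<Rightarrow> 'a) \<times> ('a list \<Rightarrow> 'a)"

text \<open>
  Cochains of every degree are triples; in degree 1 the last two entries are 0. Negative degrees,
  where the complex is 0, are omitted.
\<close>

definition cochains :: "('k::comm_ring_1 \<Rightarrow> 'a::ab_group_add \<Rightarrow> 'a) \<Rightarrow> nat \<Rightarrow> 'a cochain set" where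
  "cochains scale n =
     (if n = 0 then {0}
      else if n = 1 then Hom scale 1 \<times> {0} \<times> {0}
      else Hom scale n \<times> Hom scale (n - 1) \<times> Hom scale (n - 1))"

definition signed ::
  "('k::comm_ring_1 \<Rightarrow> 'a::ab_group_add \<Rightarrow> 'a) \<Rightarrow> nat \<Rightarrow> ('a list \<Rightarrow> 'a) \<Rightarrow> 'a list \<Rightarrow> 'a" where
  "signed scale i f = (\<lambda>xs. scale ((- 1) ^ i) (f xs))"

text \<open>Sums and differences of operations are taken pointwise.\<close>

definition differential ::
  "('k::comm_ring_1 \<Rightarrow> 'a::ab_group_add \<Rightarrow> 'a) \<Rightarrow> ('a \<Rightarrow> 'a \<Rightarrow> 'a) \<Rightarrow> ('a \<Rightarrow> 'a) \<Rightarrow> ('a \<Rightarrow> 'a) \<Rightarrow>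
   nat \<Rightarrow> 'a cochain \<Rightarrow> 'a cochain" where
  "differential scale \<mu> h \<delta> n f = (case f of (f1, f2, f3) \<Rightarrow>
     let m = nary2 \<mu>; H = nary1 h; D = nary1 \<delta>; s = signed scale in
     if n = 0 then 0
     else if n = 1 then
       (comp_at 1 1 m f1 + comp_at 2 1 m f1 - comp_at 1 2 f1 m,
        comp_at 1 1 H f1 - comp_at 1 1 f1 H,
        comp_at 1 1 D f1 - comp_at 1 1 f1 D)
     else
       (comp_at 2 n m f1 + (\<Sum>i = 1..n. s i (comp_at i 2 f1 m)) + s (n + 1) (comp_at 1 n m f1),
        comp_at 2 (n - 1) m f2 + s n (comp_at 1 (n - 1) m f2)
          + (\<Sum>i = 1..n - 1. s i (comp_at i 2 f2 m))
          + s (n - 1) (comp_at 1 n H f1 - (\<Sum>i = 1..n. comp_at i 1 f1 H)),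
        comp_at 2 (n - 1) m f2 + s n (comp_at 1 (n - 1) m f3)
          + (\<Sum>i = 1..n - 1. s i (comp_at i 2 f3 m))
          + s (n - 1) (comp_at 1 n D f1 - comp_at 1 1 f1 D - (\<Sum>i = 2..n. comp_at i 1 f1 H))))"

definition cocycles ::
  "('k::comm_ring_1 \<Rightarrow> 'a::ab_group_add \<Rightarrow> 'a) \<Rightarrow> ('a \<Rightarrow> 'a \<Rightarrow> 'a) \<Rightarrow> ('a \<Rightarrow> 'a) \<Rightarrow> ('a \<Rightarrow> 'a) \<Rightarrow>
   nat \<Rightarrow> 'a cochain set" where
  "cocycles scale \<mu> h \<delta> n = {f \<in> cochains scale n. differential scale \<mu> h \<delta> n f = 0}"

definition coboundaries ::
  "('k::comm_ring_1 \<Rightarrow> 'a::ab_group_add \<Rightarrow> 'a) \<Rightarrow> ('a \<Rightarrow> 'a \<Rightarrow> 'a) \<Rightarrow> ('a \<Rightarrow> 'a) \<Rightarrow> ('a \<Rightarrow> 'a) \<Rightarrow>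
   nat \<Rightarrow> 'a cochain set" where
  "coboundaries scale \<mu> h \<delta> n =
     (if n = 0 then {0} else differential scale \<mu> h \<delta> (n - 1) ` cochains scale (n - 1))"

definition cocycle_group ::
  "('k::comm_ring_1 \<Rightarrow> 'a::ab_group_add \<Rightarrow> 'a) \<Rightarrow> ('a \<Rightarrow> 'a \<Rightarrow> 'a) \<Rightarrow> ('a \<Rightarrow> 'a) \<Rightarrow> ('a \<Rightarrow> 'a) \<Rightarrow>
   nat \<Rightarrow> 'a cochain monoid" where
  "cocycle_group scale \<mu> h \<delta> n =
     \<lparr>carrier = cocycles scale \<mu> h \<delta> n, monoid.mult = (+), one = 0\<rparr>"

definition cohomology ::
  "('k::comm_ring_1 \<Rightarrow> 'a::ab_group_add \<Rightarrow> 'a) \<Rightarrow> ('a \<Rightarrow> 'a \<Rightarrow> 'a) \<Rightarrow> ('a \<Rightarrow> 'a) \<Rightarrow> ('a \<Rightarrow> 'a) \<Rightarrow>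
   nat \<Rightarrow> 'a cochain set monoid" where
  "cohomology scale \<mu> h \<delta> n = cocycle_group scale \<mu> h \<delta> n Mod coboundaries scale \<mu> h \<delta> n"

definition cohomology_class ::
  "('k::comm_ring_1 \<Rightarrow> 'a::ab_group_add \<Rightarrow> 'a) \<Rightarrow> ('a \<Rightarrow> 'a \<Rightarrow> 'a) \<Rightarrow> ('a \<Rightarrow> 'a) \<Rightarrow> ('a \<Rightarrow> 'a) \<Rightarrow>
   nat \<Rightarrow> 'a cochain \<Rightarrow> 'a cochain set" where
  "cohomology_class scale \<mu> h \<delta> n f =
     coboundaries scale \<mu> h \<delta> n #>\<^bsub>cocycle_group scale \<mu> h \<delta> n\<^esub> f"


section \<open>Formal deformations\<close>

text \<open>The module \<open>A[[t]]\<close> over \<open>k[[t]]\<close>.\<close>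

definition fps_scale ::
  "('k::comm_ring_1 \<Rightarrow> 'a::ab_group_add \<Rightarrow> 'a) \<Rightarrow> 'k fps \<Rightarrow> 'a fps \<Rightarrow> 'a fps" where
  "fps_scale scale c x = Abs_fps (\<lambda>n. \<Sum>i\<le>n. scale (fps_nth c i) (fps_nth x (n - i)))"

text \<open>The operations on \<open>A[[t]]\<close> given by the series of coefficients \<open>\<phi> i\<close>, respectively \<open>m i\<close>.\<close>

definition fps_map1 :: "(nat \<Rightarrow> 'a \<Rightarrow> 'a) \<Rightarrow> 'a::ab_group_add fps \<Rightarrow> 'a fps" where
  "fps_map1 \<phi> x = Abs_fps (\<lambda>n. \<Sum>i\<le>n. \<phi> i (fps_nth x (n - i)))"

definition fps_map2 ::
  "(nat \<Rightarrow> 'a \<Rightarrow> 'a \<Rightarrow> 'a) \<Rightarrow> 'a::ab_group_add fps \<Rightarrow> 'a fps \<Rightarrow> 'a fps" where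
  "fps_map2 m x y =
     Abs_fps (\<lambda>n. \<Sum>i\<le>n. \<Sum>j\<le>n - i. m i (fps_nth x j) (fps_nth y (n - i - j)))"

definition formal_deformation ::
  "('k::comm_ring_1 \<Rightarrow> 'a::ab_group_add \<Rightarrow> 'a) \<Rightarrow> ('a \<Rightarrow> 'a \<Rightarrow> 'a) \<Rightarrow> ('a \<Rightarrow> 'a) \<Rightarrow> ('a \<Rightarrow> 'a) \<Rightarrow>
   ('a fps \<Rightarrow> 'a fps \<Rightarrow> 'a fps) \<Rightarrow> ('a fps \<Rightarrow> 'a fps) \<Rightarrow> ('a fps \<Rightarrow> 'a fps) \<Rightarrow> bool" where
  "formal_deformation scale \<mu> h \<delta> \<mu>t ht \<delta>t \<longleftrightarrow>
     asgder_triple (fps_scale scale) \<mu>t ht \<delta>t \<and>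
     (\<exists>ms hs ds.
        (\<forall>i. bilin scale (ms i) \<and> module_hom scale scale (hs i) \<and> module_hom scale scale (ds i)) \<and>
        ms 0 = \<mu> \<and> hs 0 = h \<and> ds 0 = \<delta> \<and>
        \<mu>t = fps_map2 ms \<and> ht = fps_map1 hs \<and> \<delta>t = fps_map1 ds)"

definition trivial_deformation ::
  "('k::comm_ring_1 \<Rightarrow> 'a::ab_group_add \<Rightarrow> 'a) \<Rightarrow> ('a \<Rightarrow> 'a \<Rightarrow> 'a) \<Rightarrow> ('a \<Rightarrow> 'a) \<Rightarrow> ('a \<Rightarrow> 'a) \<Rightarrow>
   ('a fps \<Rightarrow> 'a fps \<Rightarrow> 'a fps) \<Rightarrow> ('a fps \<Rightarrow> 'a fps) \<Rightarrow> ('a fps \<Rightarrow> 'a fps) \<Rightarrow> bool" where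
  "trivial_deformation scale \<mu> h \<delta> \<mu>t ht \<delta>t \<longleftrightarrow>
     (\<exists>\<phi>. (\<forall>i. module_hom scale scale (\<phi> i)) \<and> \<phi> 0 = id \<and>
        asgder_iso (fps_scale scale) \<mu>t ht \<delta>t
          (fps_map2 (\<lambda>i. if i = 0 then \<mu> else (\<lambda>_ _. 0)))
          (fps_map1 (\<lambda>i. if i = 0 then h else (\<lambda>_. 0)))
          (fps_map1 (\<lambda>i. if i = 0 then \<delta> else (\<lambda>_. 0)))
          (fps_map1 \<phi>))"


section \<open>Infinitesimal deformations\<close>

text \<open>
  \<open>Dual a b\<close> stands for the class of \<open>a + b t\<close> modulo \<open>t\<^sup>2\<close>: for \<open>k\<close> a ring this is \<open>k[t]/(t\<^sup>2)\<close>,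
  for \<open>A\<close> a module it is \<open>A[[t]]/(t\<^sup>2)\<close>. The lemmas on \<open>trunc\<close> below identify it with the quotient of
  power series.
\<close>

datatype 'a dual = Dual (coeff0: 'a) (coeff1: 'a)

instantiation dual :: (ab_group_add) ab_group_add
begin
definition "0 = Dual 0 0"
definition "x + y = Dual (coeff0 x + coeff0 y) (coeff1 x + coeff1 y)"
definition "x - y = Dual (coeff0 x - coeff0 y) (coeff1 x - coeff1 y)"
definition "- x = Dual (- coeff0 x) (- coeff1 x)"
instance
  by standard
    (auto simp: zero_dual_def plus_dual_def minus_dual_def uminus_dual_def algebra_simps
      intro: dual.expand)
end

instantiation dual :: (comm_ring_1) comm_ring_1
begin
definition "1 = Dual 1 0"
definition "x * y = Dual (coeff0 x * coeff0 y) (coeff0 x * coeff1 y + coeff1 x * coeff0 y)"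
instance
  by standard
    (auto simp: zero_dual_def one_dual_def plus_dual_def times_dual_def algebra_simps
      intro: dual.expand)
end

definition dual_scale ::
  "('k::comm_ring_1 \<Rightarrow> 'a::ab_group_add \<Rightarrow> 'a) \<Rightarrow> 'k dual \<Rightarrow> 'a dual \<Rightarrow> 'a dual" where
  "dual_scale scale c x =
     Dual (scale (coeff0 c) (coeff0 x)) (scale (coeff0 c) (coeff1 x) + scale (coeff1 c) (coeff0 x))"

text \<open>The operations \<open>f0 + f1 t\<close> and \<open>m0 + m1 t\<close> on \<open>A[[t]]/(t\<^sup>2)\<close>.\<close>

definition dual_map1 :: "('a \<Rightarrow> 'a) \<Rightarrow> ('a \<Rightarrow> 'a) \<Rightarrow> 'a::ab_group_add dual \<Rightarrow> 'a dual" where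
  "dual_map1 f0 f1 x = Dual (f0 (coeff0 x)) (f0 (coeff1 x) + f1 (coeff0 x))"

definition dual_map2 ::
  "('a \<Rightarrow> 'a \<Rightarrow> 'a) \<Rightarrow> ('a \<Rightarrow> 'a \<Rightarrow> 'a) \<Rightarrow> 'a::ab_group_add dual \<Rightarrow> 'a dual \<Rightarrow> 'a dual" where
  "dual_map2 m0 m1 x y =
     Dual (m0 (coeff0 x) (coeff0 y))
       (m0 (coeff0 x) (coeff1 y) + m0 (coeff1 x) (coeff0 y) + m1 (coeff0 x) (coeff0 y))"

definition infinitesimal_deformation ::
  "('k::comm_ring_1 \<Rightarrow> 'a::ab_group_add \<Rightarrow> 'a) \<Rightarrow> ('a \<Rightarrow> 'a \<Rightarrow> 'a) \<Rightarrow> ('a \<Rightarrow> 'a) \<Rightarrow> ('a \<Rightarrow> 'a) \<Rightarrow>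
   ('a \<Rightarrow> 'a \<Rightarrow> 'a) \<Rightarrow> ('a \<Rightarrow> 'a) \<Rightarrow> ('a \<Rightarrow> 'a) \<Rightarrow> bool" where
  "infinitesimal_deformation scale \<mu> h \<delta> \<mu>1 h1 \<delta>1 \<longleftrightarrow>
     asgder_triple (dual_scale scale) (dual_map2 \<mu> \<mu>1) (dual_map1 h h1) (dual_map1 \<delta> \<delta>1)"

definition trunc :: "'a fps \<Rightarrow> 'a dual" where
  "trunc x = Dual (fps_nth x 0) (fps_nth x 1)"

lemma surj_trunc: "surj (trunc :: 'a fps \<Rightarrow> 'a dual)"
proof (rule surjI)
  fix d :: "'a dual"
  show "trunc (Abs_fps (\<lambda>n. if n = 0 then coeff0 d else coeff1 d)) = d"
    by (simp add: trunc_def)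
qed

lemma trunc_add: "trunc (x + y) = trunc x + trunc y"
  by (simp add: trunc_def plus_dual_def)

lemma trunc_one: "trunc (1 :: 'k::comm_ring_1 fps) = 1"
  by (simp add: trunc_def one_dual_def)

lemma trunc_mult: "trunc (c * d) = trunc c * trunc (d :: 'k::comm_ring_1 fps)"
  by (simp add: trunc_def times_dual_def fps_mult_nth)

lemma trunc_scale: "trunc (fps_scale scale c x) = dual_scale scale (trunc c) (trunc x)"
  by (simp add: trunc_def dual_scale_def fps_scale_def)

lemma trunc_map1: "trunc (fps_map1 \<phi> x) = dual_map1 (\<phi> 0) (\<phi> 1) (trunc x)"
  by (simp add: trunc_def dual_map1_def fps_map1_def)

lemma trunc_map2: "trunc (fps_map2 m x y) = dual_map2 (m 0) (m 1) (trunc x) (trunc y)"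
  by (simp add: trunc_def dual_map2_def fps_map2_def)

lemma trunc_eq_0_iff:
  assumes "Modules.module scale"
  shows "trunc x = 0 \<longleftrightarrow> (\<exists>y. x = fps_scale scale (fps_X ^ 2) y)"
proof -
  interpret Modules.module scale by fact
  have nth: "fps_nth (fps_scale scale (fps_X ^ 2) y) n = (if n < 2 then 0 else fps_nth y (n - 2))"
    for y n
  proof -
    have "fps_nth (fps_scale scale (fps_X ^ 2) y) n =
        (\<Sum>i\<le>n. if i = 2 then fps_nth y (n - i) else 0)"
      by (simp add: fps_scale_def fps_X_power_nth if_distrib[of "\<lambda>c. scale c _"] cong: if_cong)
    then show ?thesis by (simp add: sum.delta)
  qed
  show ?thesis
  proof
    assume "trunc x = 0"
    then have x01: "fps_nth x 0 = 0" "fps_nth x 1 = 0"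
      by (simp_all add: trunc_def zero_dual_def)
    have "fps_nth x n = 0" if "n < 2" for n
    proof -
      have "n = 0 \<or> n = 1" using that by linarith
      then show ?thesis using x01 by blast
    qed
    then have "x = fps_scale scale (fps_X ^ 2) (Abs_fps (\<lambda>n. fps_nth x (n + 2)))"
      by (simp add: fps_eq_iff nth not_less del: add_2_eq_Suc')
    then show "\<exists>y. x = fps_scale scale (fps_X ^ 2) y" ..
  next
    assume "\<exists>y. x = fps_scale scale (fps_X ^ 2) y"
    then show "trunc x = 0" by (auto simp: trunc_def zero_dual_def nth)
  qed
qed


section \<open>Obstructions and deformation equations\<close>

text \<open>
  Coefficients are given as sequences \<open>\<mu>s\<close>, \<open>hs\<close>, \<open>\<delta>s\<close>; the obstructions in degree \<open>n\<close> use only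
  the entries with index strictly between 0 and \<open>n\<close>, the equations in degree \<open>n\<close> also those of
  index \<open>n\<close>.
\<close>

definition Ob1 :: "(nat \<Rightarrow> 'a \<Rightarrow> 'a \<Rightarrow> 'a) \<Rightarrow> nat \<Rightarrow> 'a \<Rightarrow> 'a \<Rightarrow> 'a \<Rightarrow> 'a::ab_group_add" where
  "Ob1 \<mu>s n a b c = (\<Sum>i\<in>{0<..<n}. let j = n - i in \<mu>s i (\<mu>s j a b) c - \<mu>s i a (\<mu>s j b c))"

definition Ob2 ::
  "(nat \<Rightarrow> 'a \<Rightarrow> 'a \<Rightarrow> 'a) \<Rightarrow> (nat \<Rightarrow> 'a \<Rightarrow> 'a) \<Rightarrow> nat \<Rightarrow> 'a \<Rightarrow> 'a \<Rightarrow> 'a::ab_group_add" where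
  "Ob2 \<mu>s hs n a b =
     (\<Sum>i\<in>{0<..<n}. let j = n - i in hs i (\<mu>s j a b) - \<mu>s i (hs j a) b - \<mu>s i a (hs j b))"

definition Ob3 ::
  "(nat \<Rightarrow> 'a \<Rightarrow> 'a \<Rightarrow> 'a) \<Rightarrow> (nat \<Rightarrow> 'a \<Rightarrow> 'a) \<Rightarrow> (nat \<Rightarrow> 'a \<Rightarrow> 'a) \<Rightarrow>
   nat \<Rightarrow> 'a \<Rightarrow> 'a \<Rightarrow> 'a::ab_group_add" where
  "Ob3 \<mu>s hs \<delta>s n a b =
     (\<Sum>i\<in>{0<..<n}. let j = n - i in \<delta>s i (\<mu>s j a b) - \<mu>s i (\<delta>s j a) b - \<mu>s i a (hs j b))"

definition Ob ::
  "(nat \<Rightarrow> 'a \<Rightarrow> 'a \<Rightarrow> 'a) \<Rightarrow> (nat \<Rightarrow> 'a \<Rightarrow> 'a) \<Rightarrow> (nat \<Rightarrow> 'a \<Rightarrow> 'a) \<Rightarrow>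
   nat \<Rightarrow> 'a::ab_group_add cochain" where
  "Ob \<mu>s hs \<delta>s n = (nary3 (Ob1 \<mu>s n), nary2 (Ob2 \<mu>s hs n), nary2 (Ob3 \<mu>s hs \<delta>s n))"

definition DE1 ::
  "('a \<Rightarrow> 'a \<Rightarrow> 'a::ab_group_add) \<Rightarrow> (nat \<Rightarrow> 'a \<Rightarrow> 'a \<Rightarrow> 'a) \<Rightarrow> nat \<Rightarrow> bool" where
  "DE1 \<mu> \<mu>s n \<longleftrightarrow> (\<forall>a b c.
     Ob1 \<mu>s n a b c = \<mu> a (\<mu>s n b c) - \<mu>s n (\<mu> a b) c + \<mu>s n a (\<mu> b c) - \<mu> (\<mu>s n a b) c)"

definition DE2 ::
  "('a \<Rightarrow> 'a \<Rightarrow> 'a::ab_group_add) \<Rightarrow> ('a \<Rightarrow> 'a) \<Rightarrow>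
   (nat \<Rightarrow> 'a \<Rightarrow> 'a \<Rightarrow> 'a) \<Rightarrow> (nat \<Rightarrow> 'a \<Rightarrow> 'a) \<Rightarrow> nat \<Rightarrow> bool" where
  "DE2 \<mu> h \<mu>s hs n \<longleftrightarrow> (\<forall>a b.
     Ob2 \<mu>s hs n a b = \<mu>s n a (h b) + \<mu>s n (h a) b - h (\<mu>s n a b)
       + \<mu> (hs n a) b + \<mu> a (hs n b) - hs n (\<mu> a b))"

definition DE3 ::
  "('a \<Rightarrow> 'a \<Rightarrow> 'a::ab_group_add) \<Rightarrow> ('a \<Rightarrow> 'a) \<Rightarrow> ('a \<Rightarrow> 'a) \<Rightarrow>
   (nat \<Rightarrow> 'a \<Rightarrow> 'a \<Rightarrow> 'a) \<Rightarrow> (nat \<Rightarrow> 'a \<Rightarrow> 'a) \<Rightarrow> (nat \<Rightarrow> 'a \<Rightarrow> 'a) \<Rightarrow> nat \<Rightarrow> bool" where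
  "DE3 \<mu> h \<delta> \<mu>s hs \<delta>s n \<longleftrightarrow> (\<forall>a b.
     Ob3 \<mu>s hs \<delta>s n a b = \<mu>s n (\<delta> a) b + \<mu>s n a (h b) - \<delta> (\<mu>s n a b)
       + \<mu> (\<delta>s n a) b + \<mu> a (hs n b) - \<delta>s n (\<mu> a b))"

definition deformation_eqs ::
  "('a \<Rightarrow> 'a \<Rightarrow> 'a::ab_group_add) \<Rightarrow> ('a \<Rightarrow> 'a) \<Rightarrow> ('a \<Rightarrow> 'a) \<Rightarrow>
   (nat \<Rightarrow> 'a \<Rightarrow> 'a \<Rightarrow> 'a) \<Rightarrow> (nat \<Rightarrow> 'a \<Rightarrow> 'a) \<Rightarrow> (nat \<Rightarrow> 'a \<Rightarrow> 'a) \<Rightarrow> nat \<Rightarrow> bool" where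
  "deformation_eqs \<mu> h \<delta> \<mu>s hs \<delta>s n \<longleftrightarrow>
     DE1 \<mu> \<mu>s n \<and> DE2 \<mu> h \<mu>s hs n \<and> DE3 \<mu> h \<delta> \<mu>s hs \<delta>s n"

end

theory Submission
  imports Defs
begin

text \<open>
  All cocycle conditions come from identities that hold in any nonassociative algebra with linear
  maps: the associator \<open>(xy)z - x(yz)\<close>, the Leibniz defect \<open>d(xy) - d(x)y - xh(y)\<close>, and the defects
  \<open>\<Phi>(xy) - \<Phi>(x)\<Phi>(y)\<close> and \<open>\<Phi>d - d\<Phi>\<close> of a linear map \<open>\<Phi>\<close> to intertwine two structures satisfy
  them identically. They are applied in \<open>A[[t]]\<close>. If a multilinear expression over \<open>k[[t]]\<close> vanishes
  to order \<open>t\<^sup>n\<close> on constants, it does so everywhere, and its coefficient at \<open>t\<^sup>n\<close> depends only on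
  the constant terms of the arguments. The coefficient at \<open>t\<^sup>n\<close> of the identities is therefore the
  cocycle condition for the leading coefficients of the defects: for the obstruction one takes the
  operations truncated before \<open>t\<^sup>n\<close>; for the triviality of deformations one takes a \<open>\<Phi>\<close> that
  intertwines modulo \<open>t\<^sup>n\<close>, and a primitive of the leading defect corrects \<open>\<Phi>\<close> in degree \<open>n\<close>.
\<close>


section \<open>Cochains of low degree\<close>

lemma module_hom_additive: "module_hom s1 s2 f \<Longrightarrow> Modules.additive f"
  by (simp add: module_hom_iff Modules.additive_def)

lemma bilin_additive:
  assumes "bilin scale m"
  shows "Modules.additive (m a)" and "Modules.additive (\<lambda>a. m a b)"
  using assms by (auto simp: bilin_def intro: module_hom_additive)

lemma nary1_eq_iff: "nary1 f = nary1 g \<longleftrightarrow> f = g"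
  by (metis nary1.simps(1) ext)

lemma nary2_eq_iff: "nary2 f = nary2 g \<longleftrightarrow> f = g"
  by (metis nary2.simps(1) ext)

lemma nary3_eq_iff: "nary3 f = nary3 g \<longleftrightarrow> f = g"
  by (metis nary3.simps(1) ext)

lemma nary1_diff: "nary1 f - nary1 g = nary1 (\<lambda>a. f a - g a :: 'a::group_add)"
proof
  show "(nary1 f - nary1 g) xs = nary1 (\<lambda>a. f a - g a) xs" for xs
    by (cases "(f, xs)" rule: nary1.cases) auto
qed

lemma nary1_zero: "nary1 (\<lambda>_. 0 :: 'a::group_add) = 0"
  using nary1_diff[of "\<lambda>_. 0" "\<lambda>_. 0"] by simp

lemma nary2_diff: "nary2 f - nary2 g = nary2 (\<lambda>a b. f a b - g a b :: 'a::group_add)"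
proof
  show "(nary2 f - nary2 g) xs = nary2 (\<lambda>a b. f a b - g a b) xs" for xs
    by (cases "(f, xs)" rule: nary2.cases) auto
qed

lemma nary2_zero: "nary2 (\<lambda>_ _. 0 :: 'a::group_add) = 0"
  using nary2_diff[of "\<lambda>_ _. 0" "\<lambda>_ _. 0"] by simp

lemma nary3_diff: "nary3 f - nary3 g = nary3 (\<lambda>a b c. f a b c - g a b c :: 'a::group_add)"
proof
  show "(nary3 f - nary3 g) xs = nary3 (\<lambda>a b c. f a b c - g a b c) xs" for xs
    by (cases "(f, xs)" rule: nary3.cases) auto
qed

lemma nary3_zero: "nary3 (\<lambda>_ _ _. 0 :: 'a::group_add) = 0"
  using nary3_diff[of "\<lambda>_ _ _. 0" "\<lambda>_ _ _. 0"] by simp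

lemma nary1_in_Hom_iff: "nary1 f \<in> Hom scale 1 \<longleftrightarrow> module_hom scale scale f"
proof
  assume "nary1 f \<in> Hom scale 1"
  \<comment> \<open>The list \<open>[0]\<close> merely supplies the right length, its entry being
    overwritten. Leaving the update unevaluated keeps the shape that \<open>Hom\<close> quantifies
    over.\<close>
  then have "module_hom scale scale (\<lambda>x. nary1 f ([0][0 := x]))"
    unfolding Hom_def by (simp del: list_update.simps)
  then show "module_hom scale scale f" by simp
next
  assume f: "module_hom scale scale f"
  have "nary1 f xs = 0" if "length xs \<noteq> 1" for xs
    using that by (cases "(f, xs)" rule: nary1.cases) auto
  moreover have "module_hom scale scale (\<lambda>x. nary1 f (xs[i := x]))" if "length xs = 1" "i < 1" for xs i
    using that f by (auto simp: length_Suc_conv)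
  ultimately show "nary1 f \<in> Hom scale 1" by (simp add: Hom_def)
qed

lemma nary2_eq_0_iff: "nary2 f = 0 \<longleftrightarrow> f = (\<lambda>_ _. 0 :: 'a::group_add)"
  by (simp flip: nary2_zero add: nary2_eq_iff)

lemma nary2_in_Hom_iff: "nary2 m \<in> Hom scale 2 \<longleftrightarrow> bilin scale m"
proof
  assume m: "nary2 m \<in> Hom scale 2"
  have "module_hom scale scale (\<lambda>x. nary2 m ([a, b][i := x]))" if "i < 2" for a b i
    using m that unfolding Hom_def by (simp del: list_update.simps)
  from this[of 0] this[of 1] show "bilin scale m" by (simp add: bilin_def)
next
  assume m: "bilin scale m"
  have "nary2 m xs = 0" if "length xs \<noteq> 2" for xs
    using that by (cases "(m, xs)" rule: nary2.cases) auto
  moreover have "module_hom scale scale (\<lambda>x. nary2 m (xs[i := x]))" if "length xs = 2" "i < 2" for xs i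
    using that m by (auto simp: length_Suc_conv numeral_2_eq_2 less_Suc_eq bilin_def)
  ultimately show "nary2 m \<in> Hom scale 2" by (simp add: Hom_def)
qed

lemma nary3_eq_0_iff: "nary3 f = 0 \<longleftrightarrow> f = (\<lambda>_ _ _. 0 :: 'a::group_add)"
  by (simp flip: nary3_zero add: nary3_eq_iff)

lemma nary3_in_Hom:
  assumes "\<And>b c. module_hom scale scale (\<lambda>a. m a b c)"
    and "\<And>a c. module_hom scale scale (\<lambda>b. m a b c)"
    and "\<And>a b. module_hom scale scale (\<lambda>c. m a b c)"
  shows "nary3 m \<in> Hom scale 3"
proof -
  have "nary3 m xs = 0" if "length xs \<noteq> 3" for xs
    using that by (cases "(m, xs)" rule: nary3.cases) auto
  moreover have "module_hom scale scale (\<lambda>x. nary3 m (xs[i := x]))" if "length xs = 3" "i < 3" for xs i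
    using that assms by (auto simp: length_Suc_conv numeral_3_eq_3 less_Suc_eq)
  ultimately show ?thesis by (simp add: Hom_def)
qed

text \<open>Members of \<open>Hom\<close> vanish on lists of any other length, so their values on
  lists of length one determine them.\<close>

lemma Hom_1E:
  assumes "f \<in> Hom scale 1"
  obtains g where "f = nary1 g" "module_hom scale scale g"
proof
  show "f = nary1 (\<lambda>a. f [a])"
  proof
    show "f xs = nary1 (\<lambda>a. f [a]) xs" for xs
      using assms by (cases "(\<lambda>a. f [a], xs)" rule: nary1.cases) (auto simp: Hom_def)
  qed
  then show "module_hom scale scale (\<lambda>a. f [a])"
    using assms nary1_in_Hom_iff by metis
qed

lemma Hom_2E:
  assumes "f \<in> Hom scale 2"
  obtains m where "f = nary2 m" "bilin scale m"
proof
  show "f = nary2 (\<lambda>a b. f [a, b])"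
  proof
    show "f xs = nary2 (\<lambda>a b. f [a, b]) xs" for xs
      using assms by (cases "(\<lambda>a b. f [a, b], xs)" rule: nary2.cases) (auto simp: Hom_def)
  qed
  then show "bilin scale (\<lambda>a b. f [a, b])"
    using assms nary2_in_Hom_iff by metis
qed

text \<open>Serves to compare operations of arity at most 3 on all lists; the last case collects the
  lists that are too long, where both sides are 0.\<close>

lemma list_cases_upto_3:
  obtains "xs = []" | a where "xs = [a]" | a b where "xs = [a, b]" | a b c where "xs = [a, b, c]"
    | a b c d ys where "xs = a # b # c # d # ys"
  by (metis list.exhaust)

context asgder_triple
begin

section \<open>Linearity of the structure maps and explicit differentials\<close>

lemma scale_neg1_power: "scale ((- 1) ^ i) x = (if even i then x else - x)"
  by (cases "even i") (auto simp: scale_minus_left)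

lemmas linear_add = module_pair.module_hom_add[OF module_pair.intro[OF module_axioms module_axioms]]
lemmas linear_diff = module_pair.module_hom_sub[OF module_pair.intro[OF module_axioms module_axioms]]

lemma linear_sum: "(\<And>i. i \<in> I \<Longrightarrow> module_hom scale scale (f i)) \<Longrightarrow> module_hom scale scale (\<lambda>x. \<Sum>i\<in>I. f i x)"
  using module_pair.module_hom_sum[OF module_pair.intro[OF module_axioms module_axioms]] module_axioms
  by blast

lemma linear_compose:
  "module_hom scale scale g \<Longrightarrow> module_hom scale scale f \<Longrightarrow> module_hom scale scale (\<lambda>x. g (f x))"
  using module_hom_compose[unfolded comp_def] by blast

lemmas mu_additive = bilin_additive[OF mult_bilin]
lemmas h_additive = module_hom_additive[OF der_linear]
lemmas d_additive = module_hom_additive[OF gder_linear]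

lemmas op_zero [simp] =
  additive.zero[OF mu_additive(1)] additive.zero[OF mu_additive(2)]
  additive.zero[OF h_additive] additive.zero[OF d_additive]

lemmas op_add =
  additive.add[OF mu_additive(1)] additive.add[OF mu_additive(2)]
  additive.add[OF h_additive] additive.add[OF d_additive]

lemmas op_diff =
  additive.diff[OF mu_additive(1)] additive.diff[OF mu_additive(2)]
  additive.diff[OF h_additive] additive.diff[OF d_additive]

lemma differential_1:
  assumes "module_hom scale scale f"
  shows "differential scale \<mu> h \<delta> 1 (nary1 f, 0, 0) =
    (nary2 (\<lambda>a b. \<mu> a (f b) + \<mu> (f a) b - f (\<mu> a b)),
     nary1 (\<lambda>a. h (f a) - f (h a)), nary1 (\<lambda>a. \<delta> (f a) - f (\<delta> a)))"
proof -
  \<comment> \<open>On a list that is too short, an inner operation returns the junk value 0, which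
    the outer one then receives as an argument.\<close>
  have [simp]: "f 0 = 0"
    using assms module_hom_additive additive.zero by blast
  have "(comp_at 1 1 (nary2 \<mu>) (nary1 f) + comp_at 2 1 (nary2 \<mu>) (nary1 f)
      - comp_at 1 2 (nary1 f) (nary2 \<mu>)) xs
    = nary2 (\<lambda>a b. \<mu> a (f b) + \<mu> (f a) b - f (\<mu> a b)) xs" for xs
    by (rule list_cases_upto_3[of xs]) (simp_all add: comp_at_def numeral_2_eq_2 add.commute)
  moreover have "(comp_at 1 1 (nary1 g) (nary1 f) - comp_at 1 1 (nary1 f) (nary1 g)) xs
    = nary1 (\<lambda>a. g (f a) - f (g a)) xs" if "g 0 = 0" for g xs
    using that by (cases xs rule: list_cases_upto_3) (simp_all add: comp_at_def)
  ultimately show ?thesis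
    by (simp add: differential_def Let_def fun_eq_iff)
qed

text \<open>The components are the right-hand sides of the deformation equations and, up to sign,
  the coefficients at \<open>t\<close> of the axioms for an infinitesimal deformation. Both parts of
  the theorem rest on this coincidence.\<close>

lemma differential_2:
  assumes m: "bilin scale m" and f: "module_hom scale scale f" and g: "module_hom scale scale g"
  shows "differential scale \<mu> h \<delta> 2 (nary2 m, nary1 f, nary1 g) =
    (nary3 (\<lambda>a b c. \<mu> a (m b c) - m (\<mu> a b) c + m a (\<mu> b c) - \<mu> (m a b) c),
     nary2 (\<lambda>a b. m a (h b) + m (h a) b - h (m a b) + \<mu> (f a) b + \<mu> a (f b) - f (\<mu> a b)),
     nary2 (\<lambda>a b. m (\<delta> a) b + m a (h b) - \<delta> (m a b) + \<mu> (g a) b + \<mu> a (f b) - g (\<mu> a b)))"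
proof -
  have [simp]: "f 0 = 0" "g 0 = 0" "m a 0 = 0" "m 0 a = 0" for a
    using f g m module_hom_additive additive.zero bilin_additive by blast+
  have iv: "{1..2::nat} = {1, 2}" "{1..2 - 1 :: nat} = {1}" "{2..2::nat} = {2}" by auto
  show ?thesis
    unfolding differential_def Let_def iv
    apply (simp add: fun_eq_iff)
    apply (intro conjI allI)
    subgoal for xs
      by (rule list_cases_upto_3[of xs]) (simp_all add: comp_at_def signed_def scale_neg1_power eval_nat_numeral)
    subgoal for xs
      by (rule list_cases_upto_3[of xs]) (simp_all add: comp_at_def signed_def scale_neg1_power eval_nat_numeral)
    subgoal for xs
      by (rule list_cases_upto_3[of xs]) (simp_all add: comp_at_def signed_def scale_neg1_power eval_nat_numeral)
    done
qed

text \<open>The equations \<open>eq1\<close>, \<open>eq2\<close>, \<open>eq3\<close> are the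
  components on lists of their own arity 4, 3 and 3; on all other lists junk values and
  multilinearity give 0.\<close>

lemma differential_3_eq_0:
  assumes p: "\<And>b c. module_hom scale scale (\<lambda>a. p a b c)"
      "\<And>a c. module_hom scale scale (\<lambda>b. p a b c)"
      "\<And>a b. module_hom scale scale (\<lambda>c. p a b c)"
    and q: "bilin scale q" and r: "bilin scale r"
    and eq1: "\<And>a b c d. \<mu> a (p b c d) - p (\<mu> a b) c d + p a (\<mu> b c) d - p a b (\<mu> c d) + \<mu> (p a b c) d = 0"
    and eq2: "\<And>a b c. \<mu> a (q b c) - \<mu> (q a b) c - q (\<mu> a b) c + q a (\<mu> b c)
      + h (p a b c) - p (h a) b c - p a (h b) c - p a b (h c) = 0"
    and eq3: "\<And>a b c. \<mu> a (q b c) - \<mu> (r a b) c - r (\<mu> a b) c + r a (\<mu> b c)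
      + \<delta> (p a b c) - p (\<delta> a) b c - p a (h b) c - p a b (h c) = 0"
  shows "differential scale \<mu> h \<delta> 3 (nary3 p, nary2 q, nary2 r) = 0"
proof -
  have [simp]: "p 0 a b = 0" "p a 0 b = 0" "p a b 0 = 0" "q a 0 = 0" "q 0 a = 0" "r a 0 = 0" "r 0 a = 0"
    for a b
    using p q r module_hom_additive additive.zero bilin_additive by blast+
  have iv: "{1..3::nat} = {1, 2, 3}" "{1..3 - 1 :: nat} = {1, 2}" "{2..3::nat} = {2, 3}" by auto
  \<comment> \<open>The first component has arity 4, one more than \<open>list_cases_upto_3\<close>
    separates.\<close>
  have cases4: thesis if "xs = [] \<Longrightarrow> thesis" "\<And>a. xs = [a] \<Longrightarrow> thesis" "\<And>a b. xs = [a, b] \<Longrightarrow> thesis"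
    "\<And>a b c. xs = [a, b, c] \<Longrightarrow> thesis" "\<And>a b c d. xs = [a, b, c, d] \<Longrightarrow> thesis"
    "\<And>a b c d e ys. xs = a # b # c # d # e # ys \<Longrightarrow> thesis" for xs :: "'b list" and thesis
    using that by (metis list.exhaust)
  show ?thesis
    unfolding differential_def Let_def iv
    apply (simp add: fun_eq_iff zero_prod_def)
    apply (intro conjI allI)
    subgoal for xs
      using eq1 by (cases xs rule: cases4)
        (simp_all add: comp_at_def signed_def scale_neg1_power eval_nat_numeral algebra_simps)
    subgoal for xs
      using eq2 by (rule_tac list_cases_upto_3[of xs])
        (simp_all add: comp_at_def signed_def scale_neg1_power eval_nat_numeral algebra_simps)
    subgoal for xs
      using eq3 by (rule_tac list_cases_upto_3[of xs])
        (simp_all add: comp_at_def signed_def scale_neg1_power eval_nat_numeral algebra_simps)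
    done
qed

section \<open>Cocycles, coboundaries and classes in degrees 2 and 3\<close>

lemma cochains_2_iff:
  "f \<in> cochains scale 2 \<longleftrightarrow> (\<exists>m p q. f = (nary2 m, nary1 p, nary1 q) \<and>
     bilin scale m \<and> module_hom scale scale p \<and> module_hom scale scale q)"
proof
  assume "f \<in> cochains scale 2"
  then obtain f1 f2 f3 where f: "f = (f1, f2, f3)" "f1 \<in> Hom scale 2" "f2 \<in> Hom scale 1" "f3 \<in> Hom scale 1"
    by (auto simp: cochains_def)
  show "\<exists>m p q. f = (nary2 m, nary1 p, nary1 q) \<and>
     bilin scale m \<and> module_hom scale scale p \<and> module_hom scale scale q"
    by (rule Hom_2E[OF f(2)], rule Hom_1E[OF f(3)], rule Hom_1E[OF f(4)]) (use f(1) in blast)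
next
  assume "\<exists>m p q. f = (nary2 m, nary1 p, nary1 q) \<and>
     bilin scale m \<and> module_hom scale scale p \<and> module_hom scale scale q"
  then show "f \<in> cochains scale 2"
    using nary2_in_Hom_iff nary1_in_Hom_iff by (fastforce simp: cochains_def)
qed

lemma coboundaries_2_iff:
  "f \<in> coboundaries scale \<mu> h \<delta> 2 \<longleftrightarrow>
     (\<exists>g. module_hom scale scale g \<and> f = differential scale \<mu> h \<delta> 1 (nary1 g, 0, 0))"
proof -
  have "cochains scale 1 = (\<lambda>g. (nary1 g, 0, 0)) ` {g. module_hom scale scale g}"
  proof (intro equalityI subsetI)
    fix f assume "f \<in> cochains scale 1"
    then obtain f1 where f: "f = (f1, 0, 0)" and "f1 \<in> Hom scale 1"
      by (auto simp: cochains_def)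
    then obtain g where "f1 = nary1 g" "module_hom scale scale g" by (elim Hom_1E)
    then show "f \<in> (\<lambda>g. (nary1 g, 0, 0)) ` {g. module_hom scale scale g}"
      using f by blast
  next
    fix f :: "'m cochain" assume "f \<in> (\<lambda>g. (nary1 g, 0, 0)) ` {g. module_hom scale scale g}"
    then obtain g where "f = (nary1 g, 0, 0)" "module_hom scale scale g" by blast
    then show "f \<in> cochains scale 1"
      using nary1_in_Hom_iff[of g scale] by (simp add: cochains_def)
  qed
  then show ?thesis by (auto simp: coboundaries_def)
qed

lemma cocycles_2_iff:
  assumes m: "bilin scale m" and f: "module_hom scale scale f" and g: "module_hom scale scale g"
  shows "(nary2 m, nary1 f, nary1 g) \<in> cocycles scale \<mu> h \<delta> 2 \<longleftrightarrow>
    (\<forall>a b c. \<mu> a (m b c) - m (\<mu> a b) c + m a (\<mu> b c) - \<mu> (m a b) c = 0) \<and>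
    (\<forall>a b. m a (h b) + m (h a) b - h (m a b) + \<mu> (f a) b + \<mu> a (f b) - f (\<mu> a b) = 0) \<and>
    (\<forall>a b. m (\<delta> a) b + m a (h b) - \<delta> (m a b) + \<mu> (g a) b + \<mu> a (f b) - g (\<mu> a b) = 0)"
proof -
  have "(nary2 m, nary1 f, nary1 g) \<in> cochains scale 2"
    using assms cochains_2_iff by blast
  then show ?thesis
    unfolding cocycles_def mem_Collect_eq differential_2[OF assms] zero_prod_def prod.inject
      nary2_eq_0_iff nary3_eq_0_iff
    by (simp add: fun_eq_iff)
qed

lemma coboundaries_3_iff:
  "f \<in> coboundaries scale \<mu> h \<delta> 3 \<longleftrightarrow>
    (\<exists>m p q. bilin scale m \<and> module_hom scale scale p \<and> module_hom scale scale q \<and>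
      f = differential scale \<mu> h \<delta> 2 (nary2 m, nary1 p, nary1 q))"
proof -
  have cob: "coboundaries scale \<mu> h \<delta> 3 = differential scale \<mu> h \<delta> 2 ` cochains scale 2"
    by (simp add: coboundaries_def)
  show ?thesis unfolding cob image_iff Bex_def cochains_2_iff by blast
qed

lemma zero_in_coboundaries_2: "0 \<in> coboundaries scale \<mu> h \<delta> 2"
proof -
  have zero: "module_hom scale scale (\<lambda>_. 0)" by (simp add: module_hom_iff module_axioms)
  have "differential scale \<mu> h \<delta> 1 (nary1 (\<lambda>_. 0), 0, 0) = 0"
    unfolding differential_1[OF zero] by (simp add: nary1_zero nary2_zero zero_prod_def)
  then show ?thesis unfolding coboundaries_2_iff using zero by metis
qed

text \<open>The explicit form of the differential is additive in the primitive. Closure under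
  differences is the convenient form, since it yields both the zero element and sums.\<close>

lemma coboundaries_3_diff:
  assumes "f \<in> coboundaries scale \<mu> h \<delta> 3" "g \<in> coboundaries scale \<mu> h \<delta> 3"
  shows "f - g \<in> coboundaries scale \<mu> h \<delta> 3"
proof -
  from assms obtain m p q m' p' q' where
    m: "bilin scale m" "module_hom scale scale p" "module_hom scale scale q" and
    m': "bilin scale m'" "module_hom scale scale p'" "module_hom scale scale q'" and
    fg: "f = differential scale \<mu> h \<delta> 2 (nary2 m, nary1 p, nary1 q)"
        "g = differential scale \<mu> h \<delta> 2 (nary2 m', nary1 p', nary1 q')"
    unfolding coboundaries_3_iff by blast
  define M P Q where "M = (\<lambda>a b. m a b - m' a b)" and "P = (\<lambda>a. p a - p' a)" and "Q = (\<lambda>a. q a - q' a)"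
  have M: "bilin scale M" "module_hom scale scale P" "module_hom scale scale Q"
    using m m' unfolding M_def P_def Q_def by (auto simp: bilin_def intro!: linear_diff)
  have "f - g = differential scale \<mu> h \<delta> 2 (nary2 M, nary1 P, nary1 Q)"
    unfolding fg differential_2[OF m] differential_2[OF m'] differential_2[OF M]
      minus_prod_def fst_conv snd_conv nary2_diff nary3_diff
    by (simp add: M_def P_def Q_def op_diff algebra_simps)
  then show ?thesis using M coboundaries_3_iff by blast
qed

lemma zero_in_coboundaries_3: "0 \<in> coboundaries scale \<mu> h \<delta> 3"
proof -
  \<comment> \<open>Zero is obtained as a coboundary minus itself; the structure maps provide a
    cochain to start from.\<close>
  have "differential scale \<mu> h \<delta> 2 (nary2 \<mu>, nary1 h, nary1 \<delta>) \<in> coboundaries scale \<mu> h \<delta> 3"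
    using mult_bilin der_linear gder_linear coboundaries_3_iff by blast
  from coboundaries_3_diff[OF this this] show ?thesis by simp
qed

text \<open>The neutral element is the set \<open>?B\<close> of coboundaries and the class is the
  translate of \<open>?B\<close> by \<open>f\<close>. The two sets are compared directly:
  \<open>0 \<in> ?B\<close> puts \<open>f\<close> into the translate, and conversely each
  \<open>b\<close> is \<open>(b - f) + f\<close>.\<close>

lemma cohomology_class_eq_one_iff:
  "cohomology_class scale \<mu> h \<delta> 3 f = \<one>\<^bsub>cohomology scale \<mu> h \<delta> 3\<^esub> \<longleftrightarrow> f \<in> coboundaries scale \<mu> h \<delta> 3"
    (is "?c = ?e \<longleftrightarrow> f \<in> ?B")
proof -
  have c: "?c = (\<lambda>b. b + f) ` ?B" and e: "?e = ?B"
    by (auto simp: cohomology_class_def r_coset_def cocycle_group_def cohomology_def)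
  have plus: "b + g \<in> ?B" if "b \<in> ?B" "g \<in> ?B" for b g
    using coboundaries_3_diff[OF that(1) coboundaries_3_diff[OF zero_in_coboundaries_3 that(2)]] by simp
  show ?thesis
  proof
    assume "?c = ?e"
    then have "0 + f \<in> ?B" using zero_in_coboundaries_3 unfolding c e by blast
    then show "f \<in> ?B" by simp
  next
    assume f: "f \<in> ?B"
    have "b \<in> (\<lambda>b. b + f) ` ?B" if "b \<in> ?B" for b
      using coboundaries_3_diff[OF that f] by (intro image_eqI[of _ _ "b - f"]) simp_all
    then show "?c = ?e" unfolding c e using plus[OF _ f] by blast
  qed
qed

text \<open>A cocycle lies in its own class because 0 is a coboundary, and the only class is the set
  of coboundaries.\<close>

lemma trivial_cohomology_imp_coboundary:
  assumes "trivial_group (cohomology scale \<mu> h \<delta> n)" and "f \<in> cocycles scale \<mu> h \<delta> n"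
    and "0 \<in> coboundaries scale \<mu> h \<delta> n"
  shows "f \<in> coboundaries scale \<mu> h \<delta> n"
proof -
  have "f \<in> cohomology_class scale \<mu> h \<delta> n f"
    using assms(3) by (force simp: cohomology_class_def r_coset_def cocycle_group_def)
  also have "cohomology_class scale \<mu> h \<delta> n f \<in> carrier (cohomology scale \<mu> h \<delta> n)"
    using assms(2) by (simp add: cohomology_def cohomology_class_def carrier_FactGroup cocycle_group_def)
  then have "cohomology_class scale \<mu> h \<delta> n f = coboundaries scale \<mu> h \<delta> n"
    using assms(1) by (simp add: trivial_group_def cohomology_def)
  finally show ?thesis .
qed

end


section \<open>Power series\<close>

unbundle fps_syntax

text \<open>Multiplication by \<open>t\<close>. The coefficients lie in a module without ring
  structure, so it is a shift and not a product with \<open>fps_X\<close>.\<close>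

definition fps_up :: "'a::zero fps \<Rightarrow> 'a fps" where
  "fps_up x = Abs_fps (case_nat 0 (fps_nth x))"

lemma fps_up_nth [simp]: "fps_up x $ 0 = 0" "fps_up x $ Suc n = x $ n"
  by (simp_all add: fps_up_def)

lemma fps_split: "x = fps_const (x $ 0) + fps_up (fps_shift 1 x)"
  for x :: "'a::comm_monoid_add fps"
proof (rule fps_ext)
  show "x $ n = (fps_const (x $ 0) + fps_up (fps_shift 1 x)) $ n" for n
    by (cases n) auto
qed

text \<open>Stands in for linearity over k[[t]]: splitting off constant terms uses only sums and
  multiplication by \<open>t\<close>.\<close>

definition fps_linear :: "('a::ab_group_add fps \<Rightarrow> 'a fps) \<Rightarrow> bool" where
  "fps_linear G \<longleftrightarrow> Modules.additive G \<and> (\<forall>x. G (fps_up x) = fps_up (G x))"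

lemma fps_linear_compose: "fps_linear F \<Longrightarrow> fps_linear G \<Longrightarrow> fps_linear (\<lambda>x. F (G x))"
  by (simp add: fps_linear_def additive_def)

lemma fps_linear_diff: "fps_linear F \<Longrightarrow> fps_linear G \<Longrightarrow> fps_linear (\<lambda>x. F x - G x)"
  by (auto simp: fps_linear_def additive_def fps_eq_iff fps_up_def split: nat.split)

lemma fps_linear_nth:
  assumes "fps_linear G"
  shows "G x $ n = G (fps_const (x $ 0)) $ n + (case n of 0 \<Rightarrow> 0 | Suc k \<Rightarrow> G (fps_shift 1 x) $ k)"
proof -
  have "G x = G (fps_const (x $ 0)) + fps_up (G (fps_shift 1 x))"
    using assms arg_cong[OF fps_split[of x], of G] unfolding fps_linear_def by (metis additive.add)
  then show ?thesis by (cases n) (simp_all only: fps_add_nth fps_up_nth nat.case)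
qed

text \<open>Split off the constant term. The rest is \<open>t\<close> times a series, and
  contributes at degree \<open>Suc m\<close> the value of \<open>F\<close> on that series at degree
  \<open>m\<close>; by induction this is a value on a constant, which vanishes by
  \<open>low\<close>.\<close>

lemma fps_linear_low_order:
  assumes F: "fps_linear F" and low: "\<And>a k. k < n \<Longrightarrow> F (fps_const a) $ k = 0"
  shows "m \<le> n \<Longrightarrow> F x $ m = F (fps_const (x $ 0)) $ m"
proof (induction m arbitrary: x)
  case 0
  show ?case using fps_linear_nth[OF F, of x 0] by simp
next
  case (Suc m)
  then have "F (fps_shift 1 x) $ m = 0" using low by simp
  then show ?case using fps_linear_nth[OF F, of x "Suc m"] by simp
qed

text \<open>One argument at a time: with \<open>x\<close> constant the linear case reduces
  \<open>y\<close> to its constant term. This also shows vanishing below \<open>n\<close> for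
  arbitrary \<open>y\<close>, which is what the linear case in \<open>x\<close> requires.\<close>

lemma fps_bilinear_low_order:
  assumes F: "\<And>x. fps_linear (F x)" "\<And>y. fps_linear (\<lambda>x. F x y)"
    and low: "\<And>a b k. k < n \<Longrightarrow> F (fps_const a) (fps_const b) $ k = 0"
    and "m \<le> n"
  shows "F x y $ m = F (fps_const (x $ 0)) (fps_const (y $ 0)) $ m"
proof -
  have 1: "F (fps_const a) y $ k = F (fps_const a) (fps_const (y $ 0)) $ k" if "k \<le> n" for a y k
    by (rule fps_linear_low_order[where F = "F (fps_const a)" and n = n]) (use F(1) low that in auto)
  then have "F (fps_const a) y $ k = 0" if "k < n" for a y k
    using low[OF that] that by (metis less_imp_le)
  then have "F x y $ m = F (fps_const (x $ 0)) y $ m"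
    using fps_linear_low_order[of "\<lambda>x. F x y" n m x] F(2) \<open>m \<le> n\<close> by simp
  also note 1[OF \<open>m \<le> n\<close>]
  finally show ?thesis .
qed

lemma fps_trilinear_low_order:
  assumes F: "\<And>x y. fps_linear (F x y)" "\<And>x z. fps_linear (\<lambda>y. F x y z)" "\<And>y z. fps_linear (\<lambda>x. F x y z)"
    and low: "\<And>a b c k. k < n \<Longrightarrow> F (fps_const a) (fps_const b) (fps_const c) $ k = 0"
    and "m \<le> n"
  shows "F x y z $ m = F (fps_const (x $ 0)) (fps_const (y $ 0)) (fps_const (z $ 0)) $ m"
proof -
  have 1: "F (fps_const a) y z $ k = F (fps_const a) (fps_const (y $ 0)) (fps_const (z $ 0)) $ k"
    if "k \<le> n" for a y z k
    by (rule fps_bilinear_low_order[where F = "F (fps_const a)" and n = n]) (use F(1,2) low that in auto)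
  then have "F (fps_const a) y z $ k = 0" if "k < n" for a y z k
    using low[OF that] that by (metis less_imp_le)
  then have "F x y z $ m = F (fps_const (x $ 0)) y z $ m"
    using fps_linear_low_order[of "\<lambda>x. F x y z" n m x] F(3) \<open>m \<le> n\<close> by simp
  also note 1[OF \<open>m \<le> n\<close>]
  finally show ?thesis .
qed

section \<open>Coefficients of the operations on power series\<close>

lemma fps_map1_nth: "fps_map1 \<phi> x $ n = (\<Sum>i\<le>n. \<phi> i (x $ (n - i)))"
  by (simp add: fps_map1_def)

lemma fps_map2_nth: "fps_map2 m x y $ n = (\<Sum>i\<le>n. \<Sum>j\<le>n - i. m i (x $ j) (y $ (n - i - j)))"
  by (simp add: fps_map2_def)

text \<open>Transfers facts about the right argument to the left one; the inner sum is read
  backwards.\<close>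

lemma fps_map2_flip: "fps_map2 m x y = fps_map2 (\<lambda>i a b. m i b a) y x"
proof (rule fps_ext)
  fix n
  have *: "(\<Sum>j\<le>k. m i (x $ j) (y $ (k - j))) = (\<Sum>j\<le>k. m i (x $ (k - j)) (y $ j))" for i k
    by (rule sum.reindex_bij_witness[where i = "\<lambda>j. k - j" and j = "\<lambda>j. k - j"]) auto
  then show "fps_map2 m x y $ n = fps_map2 (\<lambda>i a b. m i b a) y x $ n"
    by (simp only: fps_map2_nth *)
qed

lemma fps_linear_map1:
  assumes "\<And>i. Modules.additive (\<phi> i)"
  shows "fps_linear (fps_map1 \<phi>)"
  unfolding fps_linear_def
proof (intro conjI allI)
  show "Modules.additive (fps_map1 \<phi>)"
    by standard (simp add: fps_eq_iff fps_map1_nth additive.add[OF assms] sum.distrib)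
next
  fix x
  show "fps_map1 \<phi> (fps_up x) = fps_up (fps_map1 \<phi> x)"
  proof (rule fps_ext)
    fix n
    show "fps_map1 \<phi> (fps_up x) $ n = fps_up (fps_map1 \<phi> x) $ n"
      by (cases n) (simp_all add: fps_map1_nth Suc_diff_le additive.zero[OF assms])
  qed
qed

lemma fps_linear_map2_right:
  assumes "\<And>i a. Modules.additive (m i a)"
  shows "fps_linear (fps_map2 m x)"
  unfolding fps_linear_def
proof (intro conjI allI)
  show "Modules.additive (fps_map2 m x)"
    by standard (simp add: fps_eq_iff fps_map2_nth additive.add[OF assms] sum.distrib)
next
  fix y
  show "fps_map2 m x (fps_up y) = fps_up (fps_map2 m x y)"
  proof (rule fps_ext)
    fix n
    show "fps_map2 m x (fps_up y) $ n = fps_up (fps_map2 m x y) $ n"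
      by (cases n) (simp_all add: fps_map2_nth Suc_diff_le additive.zero[OF assms])
  qed
qed

lemma fps_linear_map2_left:
  assumes "\<And>i b. Modules.additive (\<lambda>a. m i a b)"
  shows "fps_linear (\<lambda>x. fps_map2 m x y)"
  unfolding fps_map2_flip[of m] by (rule fps_linear_map2_right) (rule assms)

lemma fps_map1_const: 
  assumes "\<And>i. Modules.additive (\<phi> i)"
  shows "fps_map1 \<phi> (fps_const a) = Abs_fps (\<lambda>n. \<phi> n a)"
proof (rule fps_ext)
  fix n
  have "fps_map1 \<phi> (fps_const a) $ n = (\<Sum>i\<le>n. if i = n then \<phi> i a else 0)"
    unfolding fps_map1_nth by (rule sum.cong) (auto simp: additive.zero[OF assms])
  then show "fps_map1 \<phi> (fps_const a) $ n = Abs_fps (\<lambda>n. \<phi> n a) $ n" by simp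
qed

lemma fps_map2_const_left: 
  assumes "\<And>i b. Modules.additive (\<lambda>a. m i a b)"
  shows "fps_map2 m (fps_const a) y $ n = (\<Sum>i\<le>n. m i a (y $ (n - i)))"
proof -
  have "(\<Sum>j\<le>n - i. m i (fps_const a $ j) (y $ (n - i - j)))
      = (\<Sum>j\<le>n - i. if j = 0 then m i a (y $ (n - i)) else 0)" for i
    by (rule sum.cong) (auto simp: additive.zero[OF assms])
  then show ?thesis by (simp add: fps_map2_nth)
qed

lemma fps_map2_const_right: 
  assumes "\<And>i a. Modules.additive (m i a)"
  shows "fps_map2 m x (fps_const b) $ n = (\<Sum>i\<le>n. m i (x $ (n - i)) b)"
  unfolding fps_map2_flip[of m] by (rule fps_map2_const_left) (rule assms)

lemma fps_map2_const_const: 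
  assumes "\<And>i b. Modules.additive (\<lambda>a. m i a b)" and "\<And>i a. Modules.additive (m i a)"
  shows "fps_map2 m (fps_const a) (fps_const b) = Abs_fps (\<lambda>n. m n a b)"
proof (rule fps_ext)
  fix n
  have "fps_map2 m (fps_const a) (fps_const b) $ n = (\<Sum>i\<le>n. if i = n then m i a b else 0)"
    unfolding fps_map2_const_left[OF assms(1)] by (rule sum.cong) (auto simp: additive.zero[OF assms(2)])
  then show "fps_map2 m (fps_const a) (fps_const b) $ n = Abs_fps (\<lambda>n. m n a b) $ n" by simp
qed

text \<open>When \<open>x\<close> starts in degree \<open>n\<close>, only the undeformed coefficient
  \<open>\<phi> 0\<close> meets its leading term. This and the two-argument versions turn identities
  between series into identities for the original structure.\<close>

lemma fps_map1_high_order: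
  assumes "\<And>i. Modules.additive (\<phi> i)" and low: "\<And>k. k < n \<Longrightarrow> x $ k = 0"
  shows "fps_map1 \<phi> x $ n = \<phi> 0 (x $ n)"
proof -
  have "fps_map1 \<phi> x $ n = (\<Sum>i\<le>n. if i = 0 then \<phi> 0 (x $ n) else 0)"
    unfolding fps_map1_nth by (rule sum.cong) (auto simp: additive.zero[OF assms(1)] low)
  then show ?thesis by simp
qed

lemma fps_map2_high_order_right:
  assumes "\<And>i a. Modules.additive (m i a)" and low: "\<And>k. k < n \<Longrightarrow> y $ k = 0"
  shows "fps_map2 m x y $ n = m 0 (x $ 0) (y $ n)"
proof -
  have "m i (x $ j) (y $ (n - i - j)) = (if j = 0 then if i = 0 then m 0 (x $ 0) (y $ n) else 0 else 0)"
    if "i \<le> n" "j \<le> n - i" for i j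
    using that by (auto simp: additive.zero[OF assms(1)] low)
  then have "fps_map2 m x y $ n
      = (\<Sum>i\<le>n. \<Sum>j\<le>n - i. if j = 0 then if i = 0 then m 0 (x $ 0) (y $ n) else 0 else 0)"
    unfolding fps_map2_nth by (intro sum.cong refl) auto
  then show ?thesis by simp
qed

lemma fps_map2_high_order_left:
  assumes "\<And>i b. Modules.additive (\<lambda>a. m i a b)" and low: "\<And>k. k < n \<Longrightarrow> x $ k = 0"
  shows "fps_map2 m x y $ n = m 0 (x $ n) (y $ 0)"
  unfolding fps_map2_flip[of m] by (rule fps_map2_high_order_right) (use assms in auto)


section \<open>Infinitesimal deformations\<close>

context asgder_triple
begin

lemma dual_module: "Modules.module (dual_scale scale)"
  by standard
    (auto simp: dual_scale_def plus_dual_def times_dual_def one_dual_def scale_right_distrib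
      scale_left_distrib ac_simps)

text \<open>The coefficient at \<open>t^0\<close> of each axiom holds in the original triple. The
  coefficient at \<open>t\<close> yields the equations when evaluated on constants, and follows from
  them by biadditivity.\<close>

lemma infinitesimal_deformation_iff:
  assumes m: "bilin scale m" and f: "module_hom scale scale f" and g: "module_hom scale scale g"
  shows "infinitesimal_deformation scale \<mu> h \<delta> m f g \<longleftrightarrow>
    (\<forall>a b c. \<mu> a (m b c) - m (\<mu> a b) c + m a (\<mu> b c) - \<mu> (m a b) c = 0) \<and>
    (\<forall>a b. m a (h b) + m (h a) b - h (m a b) + \<mu> (f a) b + \<mu> a (f b) - f (\<mu> a b) = 0) \<and>
    (\<forall>a b. m (\<delta> a) b + m a (h b) - \<delta> (m a b) + \<mu> (g a) b + \<mu> a (f b) - g (\<mu> a b) = 0)"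
    (is "?inf \<longleftrightarrow> ?eqs")
proof -
  note add = bilin_additive[OF m, THEN additive.add] bilin_additive[OF m, THEN additive.zero]
    module_hom_additive[OF f, THEN additive.add] module_hom_additive[OF g, THEN additive.add]
    module_hom_additive[OF f, THEN additive.zero] module_hom_additive[OF g, THEN additive.zero]
  have hom: "module_hom (dual_scale scale) (dual_scale scale) (dual_map1 f0 f1)"
    if "module_hom scale scale f0" "module_hom scale scale f1" for f0 f1
    using that dual_module
    by (auto simp: module_hom_iff dual_map1_def dual_scale_def plus_dual_def scale_right_distrib ac_simps)
  have bilin: "bilin (dual_scale scale) (dual_map2 \<mu> m)"
    using m mult_bilin dual_module
    by (auto simp: bilin_def module_hom_iff dual_map2_def dual_scale_def plus_dual_def scale_right_distrib ac_simps)
  have inf_iff: "?inf \<longleftrightarrow>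
      (\<forall>x y z. dual_map2 \<mu> m (dual_map2 \<mu> m x y) z = dual_map2 \<mu> m x (dual_map2 \<mu> m y z)) \<and>
      (\<forall>x y. dual_map1 h f (dual_map2 \<mu> m x y)
        = dual_map2 \<mu> m (dual_map1 h f x) y + dual_map2 \<mu> m x (dual_map1 h f y)) \<and>
      (\<forall>x y. dual_map1 \<delta> g (dual_map2 \<mu> m x y)
        = dual_map2 \<mu> m (dual_map1 \<delta> g x) y + dual_map2 \<mu> m x (dual_map1 h f y))"
    using hom[OF der_linear f] hom[OF gder_linear g] bilin dual_module
    by (auto simp: infinitesimal_deformation_def asgder_triple_def asgder_triple_axioms_def)
  show ?thesis
  proof
    assume ?inf
    then have 1: "dual_map2 \<mu> m (dual_map2 \<mu> m (Dual a 0) (Dual b 0)) (Dual c 0)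
          = dual_map2 \<mu> m (Dual a 0) (dual_map2 \<mu> m (Dual b 0) (Dual c 0))"
      and 2: "dual_map1 h f (dual_map2 \<mu> m (Dual a 0) (Dual b 0))
        = dual_map2 \<mu> m (dual_map1 h f (Dual a 0)) (Dual b 0) + dual_map2 \<mu> m (Dual a 0) (dual_map1 h f (Dual b 0))"
      and 3: "dual_map1 \<delta> g (dual_map2 \<mu> m (Dual a 0) (Dual b 0))
        = dual_map2 \<mu> m (dual_map1 \<delta> g (Dual a 0)) (Dual b 0) + dual_map2 \<mu> m (Dual a 0) (dual_map1 h f (Dual b 0))"
      for a b c unfolding inf_iff by blast+
    show ?eqs
    proof (intro conjI allI)
      show "\<mu> a (m b c) - m (\<mu> a b) c + m a (\<mu> b c) - \<mu> (m a b) c = 0" for a b c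
        using 1[of a b c] by (simp add: dual_map2_def add algebra_simps)
      show "m a (h b) + m (h a) b - h (m a b) + \<mu> (f a) b + \<mu> a (f b) - f (\<mu> a b) = 0" for a b
        using 2[of a b] by (simp add: dual_map2_def dual_map1_def plus_dual_def add algebra_simps)
      show "m (\<delta> a) b + m a (h b) - \<delta> (m a b) + \<mu> (g a) b + \<mu> a (f b) - g (\<mu> a b) = 0" for a b
        using 3[of a b] by (simp add: dual_map2_def dual_map1_def plus_dual_def add algebra_simps)
    qed
  next
    assume ?eqs
    \<comment> \<open>Each equation is solved for one term, so that it can rewrite alongside
      \<open>mult_assoc\<close>, \<open>der\<close> and \<open>gder\<close>.\<close>
    then have 1: "\<mu> (m a b) c = \<mu> a (m b c) - m (\<mu> a b) c + m a (\<mu> b c)"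
      and 2: "f (\<mu> a b) = m a (h b) + m (h a) b - h (m a b) + \<mu> (f a) b + \<mu> a (f b)"
      and 3: "g (\<mu> a b) = m (\<delta> a) b + m a (h b) - \<delta> (m a b) + \<mu> (g a) b + \<mu> a (f b)" for a b c
      by auto
    show ?inf
      unfolding inf_iff
      by (simp add: dual_map2_def dual_map1_def plus_dual_def add op_add mult_assoc der gder 1 2 3)
  qed
qed

lemma infinitesimal_deformation_iff_cocycle:
  assumes "bilin scale m" "module_hom scale scale f" "module_hom scale scale g"
  shows "infinitesimal_deformation scale \<mu> h \<delta> m f g \<longleftrightarrow>
    (nary2 m, nary1 f, nary1 g) \<in> cocycles scale \<mu> h \<delta> 2"
  using infinitesimal_deformation_iff[OF assms] cocycles_2_iff[OF assms] by simp

end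


section \<open>Obstructions\<close>

text \<open>The coefficient at \<open>t^n\<close> of the associator on constants. In contrast to
  \<open>Ob1\<close>, the indices 0 and \<open>n\<close> are included.\<close>

definition associator_coeff :: "(nat \<Rightarrow> 'a \<Rightarrow> 'a \<Rightarrow> 'a) \<Rightarrow> nat \<Rightarrow> 'a \<Rightarrow> 'a \<Rightarrow> 'a \<Rightarrow> 'a::ab_group_add" where
  "associator_coeff ms n a b c = (\<Sum>i\<le>n. ms i (ms (n - i) a b) c - ms i a (ms (n - i) b c))"

definition leibniz_coeff ::
  "(nat \<Rightarrow> 'a \<Rightarrow> 'a \<Rightarrow> 'a) \<Rightarrow> (nat \<Rightarrow> 'a \<Rightarrow> 'a) \<Rightarrow> (nat \<Rightarrow> 'a \<Rightarrow> 'a) \<Rightarrow> nat \<Rightarrow> 'a \<Rightarrow> 'a \<Rightarrow> 'a::ab_group_add" where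
  "leibniz_coeff ms hs ds n a b =
    (\<Sum>i\<le>n. ds i (ms (n - i) a b) - ms i (ds (n - i) a) b - ms i a (hs (n - i) b))"

text \<open>No axiom beyond additivity is imposed, because the truncated series used for the
  obstruction need not form an AsGDer triple.\<close>

locale additive_series =
  fixes ms :: "nat \<Rightarrow> 'a::ab_group_add \<Rightarrow> 'a \<Rightarrow> 'a" and hs ds :: "nat \<Rightarrow> 'a \<Rightarrow> 'a"
  assumes ms_additive: "Modules.additive (ms i a)" "Modules.additive (\<lambda>a. ms i a b)"
    and hs_additive: "Modules.additive (hs i)" and ds_additive: "Modules.additive (ds i)"
begin

section \<open>Associator and Leibniz defect of a series of operations\<close>

abbreviation M where "M \<equiv> fps_map2 ms"
abbreviation H where "H \<equiv> fps_map1 hs"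
abbreviation D where "D \<equiv> fps_map1 ds"

definition associator where "associator x y z = M (M x y) z - M x (M y z)"
definition leibniz where "leibniz x y = D (M x y) - M (D x) y - M x (H y)"

lemmas fps_linear_MHD =
  fps_linear_map2_right[of ms, OF ms_additive(1)] fps_linear_map2_left[of ms, OF ms_additive(2)]
  fps_linear_map1[of hs, OF hs_additive] fps_linear_map1[of ds, OF ds_additive]

lemmas MHD_diff = fps_linear_MHD[unfolded fps_linear_def, THEN conjunct1, THEN additive.diff]

lemma associator_linear:
  "fps_linear (associator x y)" "fps_linear (\<lambda>y. associator x y z)" "fps_linear (\<lambda>x. associator x y z)"
  unfolding associator_def
  by (intro fps_linear_diff fps_linear_MHD
      fps_linear_compose[of "M x"] fps_linear_compose[of "\<lambda>w. M w z"] fps_linear_compose[of "M _"])+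

lemma leibniz_linear: "fps_linear (leibniz x)" "fps_linear (\<lambda>x. leibniz x y)"
  unfolding leibniz_def
  by (intro fps_linear_diff fps_linear_MHD fps_linear_compose[of D]
      fps_linear_compose[of "M x"] fps_linear_compose[of "\<lambda>w. M w y"])+

lemma associator_const:
  "associator (fps_const a) (fps_const b) (fps_const c) $ n = associator_coeff ms n a b c"
  by (simp add: associator_def associator_coeff_def fps_map2_const_const[OF ms_additive(2,1)]
      fps_map2_const_left[OF ms_additive(2)] fps_map2_const_right[OF ms_additive(1)] sum_subtractf)

lemma leibniz_const: "leibniz (fps_const a) (fps_const b) $ n = leibniz_coeff ms hs ds n a b"
  by (simp add: leibniz_def leibniz_coeff_def fps_map2_const_const[OF ms_additive(2,1)]
      fps_map1_const[OF hs_additive] fps_map1_const[OF ds_additive]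
      fps_map2_const_left[OF ms_additive(2)] fps_map2_const_right[OF ms_additive(1)] sum_subtractf
      fps_map1_nth)

text \<open>The Teichmueller identity: each of the five bracketings of four factors occurs twice,
  with opposite signs.\<close>

lemma associator_identity:
  "M x (associator y z w) - associator (M x y) z w + associator x (M y z) w
    - associator x y (M z w) + M (associator x y z) w = 0"
  by (simp add: associator_def MHD_diff)

lemma M_zero [simp]: "M x y $ 0 = ms 0 (x $ 0) (y $ 0)"
  by (simp add: fps_map2_nth)

lemma associator_nth:
  assumes "\<And>k a b c. k < n \<Longrightarrow> associator_coeff ms k a b c = 0" and "m \<le> n"
  shows "associator x y z $ m = associator_coeff ms m (x $ 0) (y $ 0) (z $ 0)"
  by (subst fps_trilinear_low_order[of associator n m x y z])
    (use assms associator_linear in \<open>simp_all add: associator_const\<close>)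

lemma leibniz_nth:
  assumes "\<And>k a b. k < n \<Longrightarrow> leibniz_coeff ms hs ds k a b = 0" and "m \<le> n"
  shows "leibniz x y $ m = leibniz_coeff ms hs ds m (x $ 0) (y $ 0)"
  by (subst fps_bilinear_low_order[of leibniz n m x y])
    (use assms leibniz_linear in \<open>simp_all add: leibniz_const\<close>)

text \<open>This is \<open>associator_identity\<close> on constants at degree \<open>n\<close>.
  Outer products act through \<open>ms 0\<close>, since the associator starts in degree
  \<open>n\<close>, and inner products enter only by their constant terms.\<close>

lemma associator_coeff_cocycle:
  assumes low: "\<And>k a b c. k < n \<Longrightarrow> associator_coeff ms k a b c = 0"
  shows "ms 0 a (associator_coeff ms n b c d) - associator_coeff ms n (ms 0 a b) c d
    + associator_coeff ms n a (ms 0 b c) d - associator_coeff ms n a b (ms 0 c d)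
    + ms 0 (associator_coeff ms n a b c) d = 0"
proof -
  \<comment> \<open>The hypothesis concerns constants only; trilinearity extends it to all
    series.\<close>
  have "associator x y z $ k = 0" if "k < n" for x y z k
    using associator_nth[OF low, where m = k] low that by simp
  note high = fps_map2_high_order_left[of ms, OF ms_additive(2) this]
    fps_map2_high_order_right[of ms, OF ms_additive(1) this]
  show ?thesis
    using arg_cong[OF associator_identity[of "fps_const a" "fps_const b" "fps_const c" "fps_const d"],
        of "\<lambda>x. x $ n"]
    by (simp add: high associator_nth[OF low])
qed

end

text \<open>Taking \<open>ds = hs\<close> covers the second component of the complex.\<close>

lemma leibniz_coeff_cocycle:
  assumes "additive_series ms hs ds"
    and low_a: "\<And>k a b c. k < n \<Longrightarrow> associator_coeff ms k a b c = 0"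
    and low_h: "\<And>k a b. k < n \<Longrightarrow> leibniz_coeff ms hs hs k a b = 0"
    and low_d: "\<And>k a b. k < n \<Longrightarrow> leibniz_coeff ms hs ds k a b = 0"
  shows "ms 0 a (leibniz_coeff ms hs hs n b c) - ms 0 (leibniz_coeff ms hs ds n a b) c
    - leibniz_coeff ms hs ds n (ms 0 a b) c + leibniz_coeff ms hs ds n a (ms 0 b c)
    + ds 0 (associator_coeff ms n a b c) - associator_coeff ms n (ds 0 a) b c
    - associator_coeff ms n a (hs 0 b) c - associator_coeff ms n a b (hs 0 c) = 0"
proof -
  interpret d: additive_series ms hs ds by fact
  interpret h: additive_series ms hs hs using d.additive_series_axioms by (simp add: additive_series_def)
  \<comment> \<open>\<open>D\<close> is expanded on both bracketings of \<open>x y z\<close>. The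
    factors to the right of \<open>x\<close> are differentiated by \<open>H\<close>, hence the
    defect of \<open>H\<close> under \<open>M x\<close>.\<close>
  have identity: "d.M x (h.leibniz y z) - d.M (d.leibniz x y) z - d.leibniz (d.M x y) z
      + d.leibniz x (d.M y z) + d.D (d.associator x y z) - d.associator (d.D x) y z
      - d.associator x (d.H y) z - d.associator x y (d.H z) = 0" for x y z
    by (simp add: d.associator_def d.leibniz_def h.leibniz_def d.MHD_diff)
  have a: "d.associator x y z $ k = 0" if "k < n" for x y z k
    using d.associator_nth[OF low_a, where m = k] low_a that by simp
  have l: "d.leibniz x y $ k = 0" if "k < n" for x y k
    using d.leibniz_nth[OF low_d, where m = k] low_d that by simp
  have l': "h.leibniz x y $ k = 0" if "k < n" for x y k
    using h.leibniz_nth[OF low_h, where m = k] low_h that by simp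
  have "d.H (fps_const b) $ 0 = hs 0 b" "d.D (fps_const b) $ 0 = ds 0 b" for b
    by (simp_all add: fps_map1_nth)
  then show ?thesis
    using arg_cong[OF identity[of "fps_const a" "fps_const b" "fps_const c"], of "\<lambda>x. x $ n"]
    by (simp add: fps_map1_high_order[of ds, OF d.ds_additive a]
      fps_map2_high_order_left[of ms, OF d.ms_additive(2) l]
      fps_map2_high_order_right[of ms, OF d.ms_additive(1) l']
      d.associator_nth[OF low_a] d.leibniz_nth[OF low_d] h.leibniz_nth[OF low_h])
qed

section \<open>From coefficients of the defects to obstructions\<close>

lemma sum_atMost_ends:
  fixes f :: "nat \<Rightarrow> 'a::comm_monoid_add"
  assumes "0 < n"
  shows "sum f {..n} = f 0 + f n + sum f {0<..<n}"
proof -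
  have "{..n} = insert 0 (insert n {0<..<n})" using assms by auto
  then show ?thesis using assms by (simp add: ac_simps)
qed

text \<open>The end terms \<open>i = 0\<close> and \<open>i = n\<close> make up the differential,
  the inner ones the obstruction; so the coefficient vanishes exactly when the deformation equation
  holds.\<close>

lemma associator_coeff_eq:
  assumes "0 < n"
  shows "associator_coeff ms n a b c = Ob1 ms n a b c
    - (ms 0 a (ms n b c) - ms n (ms 0 a b) c + ms n a (ms 0 b c) - ms 0 (ms n a b) c)"
  unfolding associator_coeff_def sum_atMost_ends[OF assms] Ob1_def Let_def by (simp add: algebra_simps)

lemma leibniz_coeff_eq:
  assumes "0 < n"
  shows "leibniz_coeff ms hs ds n a b = Ob3 ms hs ds n a b
    - (ms n (ds 0 a) b + ms n a (hs 0 b) - ds 0 (ms n a b)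
       + ms 0 (ds n a) b + ms 0 a (hs n b) - ds n (ms 0 a b))"
  unfolding leibniz_coeff_def sum_atMost_ends[OF assms] Ob3_def Let_def by (simp add: algebra_simps)

lemma Ob2_eq_Ob3: "Ob2 ms hs n = Ob3 ms hs hs n"
  by (simp add: fun_eq_iff Ob2_def Ob3_def)

lemma Ob_cong:
  assumes "\<And>i. 0 < i \<Longrightarrow> i < n \<Longrightarrow> ms i = ms' i" "\<And>i. 0 < i \<Longrightarrow> i < n \<Longrightarrow> hs i = hs' i"
    "\<And>i. 0 < i \<Longrightarrow> i < n \<Longrightarrow> ds i = ds' i"
  shows "Ob1 ms n = Ob1 ms' n" "Ob2 ms hs n = Ob2 ms' hs' n" "Ob3 ms hs ds n = Ob3 ms' hs' ds' n"
  unfolding Ob1_def Ob2_def Ob3_def Let_def fun_eq_iff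
  by (auto intro!: sum.cong simp: assms)


section \<open>Formal deformations\<close>

text \<open>Solves for a preimage of \<open>y\<close> degree by degree when \<open>\<phi> 0\<close>
  is the identity. As a simplification rule its equation would unfold without end.\<close>

fun fps_map1_inv :: "(nat \<Rightarrow> 'a \<Rightarrow> 'a) \<Rightarrow> 'a::ab_group_add fps \<Rightarrow> nat \<Rightarrow> 'a" where
  "fps_map1_inv \<phi> y n = y $ n - (\<Sum>i<n. \<phi> (n - i) (fps_map1_inv \<phi> y i))"

declare fps_map1_inv.simps [simp del]

text \<open>As \<open>\<phi> 0 = id\<close>, the leading coefficient of a nonzero series survives,
  which gives injectivity; the recursion \<open>fps_map1_inv\<close> gives surjectivity.\<close>

lemma bij_fps_map1:
  assumes additive: "\<And>i. Modules.additive (\<phi> i)" and "\<phi> 0 = id"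
  shows "bij (fps_map1 \<phi>)"
proof (rule bijI)
  interpret \<Phi>: Modules.additive "fps_map1 \<phi>"
    using fps_linear_map1[of \<phi>, OF additive] by (simp add: fps_linear_def)
  have "z = 0" if "fps_map1 \<phi> z = 0" for z
  proof (rule fps_ext)
    show "z $ n = 0 $ n" for n
    proof (induction n rule: less_induct)
      case (less n)
      then have "fps_map1 \<phi> z $ n = z $ n"
        using fps_map1_high_order[of \<phi> n z, OF additive] assms(2) by simp
      then show ?case using that by simp
    qed
  qed
  then show "inj (fps_map1 \<phi>)"
    by (intro injI) (metis \<Phi>.diff right_minus_eq)
  have "fps_map1 \<phi> (Abs_fps (fps_map1_inv \<phi> y)) = y" for y
  proof (rule fps_ext)
    fix n
    have "fps_map1 \<phi> (Abs_fps (fps_map1_inv \<phi> y)) $ n = (\<Sum>i\<le>n. \<phi> (n - i) (fps_map1_inv \<phi> y i))"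
      unfolding fps_map1_nth fps_nth_Abs_fps
      by (rule sum.reindex_bij_witness[where i = "\<lambda>i. n - i" and j = "\<lambda>i. n - i"]) auto
    also have "\<dots> = (\<Sum>i<n. \<phi> (n - i) (fps_map1_inv \<phi> y i)) + fps_map1_inv \<phi> y n"
      by (simp add: assms(2) flip: lessThan_Suc_atMost)
    also have "\<dots> = y $ n" by (subst (2) fps_map1_inv.simps) simp
    finally show "fps_map1 \<phi> (Abs_fps (fps_map1_inv \<phi> y)) $ n = y $ n" .
  qed
  then show "surj (fps_map1 \<phi>)" by (rule surjI)
qed

lemma fps_map1_scale:
  assumes "\<And>i. module_hom scale scale (\<phi> i)"
  shows "fps_map1 \<phi> (fps_scale scale c x) = fps_scale scale c (fps_map1 \<phi> x)"
proof (rule fps_ext)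
  fix n
  note hom = assms[unfolded module_hom_iff]
  have s: "\<phi> i (sum f A) = (\<Sum>j\<in>A. \<phi> i (f j))" for i f and A :: "nat set"
    using module_hom_additive[OF assms] by (rule additive.sum)
  \<comment> \<open>The module axioms for \<open>scale\<close> are extracted from
    \<open>module_hom\<close>, which includes them.\<close>
  have t: "scale r (sum f A) = (\<Sum>j\<in>A. scale r (f j))" for r f and A :: "nat set"
    using assms[of 0] module.scale_sum_right by (auto simp: module_hom_iff)
  have "fps_map1 \<phi> (fps_scale scale c x) $ n
      = (\<Sum>i\<le>n. \<Sum>j\<le>n - i. scale (c $ j) (\<phi> i (x $ (n - i - j))))"
    by (simp add: fps_map1_nth fps_scale_def s hom)
  also have "\<dots> = (\<Sum>(i, j)\<in>(SIGMA i:{..n}. {..n - i}). scale (c $ j) (\<phi> i (x $ (n - i - j))))"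
    by (rule sum.Sigma) auto
  also have "\<dots> = (\<Sum>(j, i)\<in>(SIGMA j:{..n}. {..n - j}). scale (c $ j) (\<phi> i (x $ (n - j - i))))"
    by (rule sum.reindex_bij_witness[where i = prod.swap and j = prod.swap]) (auto simp: add.commute)
  also have "\<dots> = (\<Sum>j\<le>n. \<Sum>i\<le>n - j. scale (c $ j) (\<phi> i (x $ (n - j - i))))"
    by (rule sum.Sigma[symmetric]) auto
  also have "\<dots> = fps_scale scale c (fps_map1 \<phi> x) $ n"
    by (simp add: fps_map1_nth fps_scale_def t)
  finally show "fps_map1 \<phi> (fps_scale scale c x) $ n = fps_scale scale c (fps_map1 \<phi> x) $ n" .
qed

text \<open>
  The defects measure the failure of \<open>\<Sum>i. \<phi> i t\<^sup>i\<close> to intertwine the deformed operations with the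
  original ones.
\<close>

definition mult_defect ::
  "('a \<Rightarrow> 'a \<Rightarrow> 'a) \<Rightarrow> (nat \<Rightarrow> 'a \<Rightarrow> 'a \<Rightarrow> 'a) \<Rightarrow> (nat \<Rightarrow> 'a \<Rightarrow> 'a) \<Rightarrow> nat \<Rightarrow> 'a \<Rightarrow> 'a \<Rightarrow> 'a::ab_group_add" where
  "mult_defect \<mu> ms \<phi> n a b = (\<Sum>i\<le>n. \<phi> i (ms (n - i) a b)) - (\<Sum>i\<le>n. \<mu> (\<phi> i a) (\<phi> (n - i) b))"

definition map_defect ::
  "('a \<Rightarrow> 'a) \<Rightarrow> (nat \<Rightarrow> 'a \<Rightarrow> 'a) \<Rightarrow> (nat \<Rightarrow> 'a \<Rightarrow> 'a) \<Rightarrow> nat \<Rightarrow> 'a \<Rightarrow> 'a::ab_group_add" where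
  "map_defect g gs \<phi> n a = (\<Sum>i\<le>n. \<phi> i (gs (n - i) a)) - g (\<phi> n a)"

lemma mult_defect_cong: "(\<And>i. i \<le> n \<Longrightarrow> \<phi> i = \<psi> i) \<Longrightarrow> mult_defect \<mu> ms \<phi> n = mult_defect \<mu> ms \<psi> n"
  by (auto simp: mult_defect_def fun_eq_iff)

lemma map_defect_cong: "(\<And>i. i \<le> n \<Longrightarrow> \<phi> i = \<psi> i) \<Longrightarrow> map_defect g gs \<phi> n = map_defect g gs \<psi> n"
  by (auto simp: map_defect_def fun_eq_iff)

text \<open>The inner terms avoid index \<open>n\<close>, and at the ends \<open>\<psi>\<close>
  meets \<open>\<phi> 0 = id\<close>. The change is minus the first component of the differential of
  \<open>\<psi>\<close>, so a primitive of the defect cancels it.\<close>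

lemma mult_defect_update:
  assumes "\<And>a. Modules.additive (\<mu> a)" "\<And>b. Modules.additive (\<lambda>a. \<mu> a b)"
    and "0 < n" "\<phi> 0 = id"
  shows "mult_defect \<mu> ms (\<phi>(n := \<lambda>a. \<phi> n a + \<psi> a)) n a b
    = mult_defect \<mu> ms \<phi> n a b - (\<mu> a (\<psi> b) + \<mu> (\<psi> a) b - \<psi> (ms 0 a b))"
proof -
  let ?\<phi> = "\<phi>(n := \<lambda>a. \<phi> n a + \<psi> a)"
  have "(\<Sum>i\<in>{0<..<n}. \<mu> (?\<phi> i a) (?\<phi> (n - i) b)) = (\<Sum>i\<in>{0<..<n}. \<mu> (\<phi> i a) (\<phi> (n - i) b))"
    "(\<Sum>i\<in>{0<..<n}. ?\<phi> i (ms (n - i) a b)) = (\<Sum>i\<in>{0<..<n}. \<phi> i (ms (n - i) a b))"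
    by (auto intro!: sum.cong)
  then show ?thesis
    unfolding mult_defect_def sum_atMost_ends[OF \<open>0 < n\<close>]
    using assms(3,4) by (simp add: additive.add[OF assms(1)] additive.add[OF assms(2)])
qed

lemma map_defect_update:
  assumes "Modules.additive g" and "0 < n" "\<phi> 0 = id"
  shows "map_defect g gs (\<phi>(n := \<lambda>a. \<phi> n a + \<psi> a)) n a = map_defect g gs \<phi> n a - (g (\<psi> a) - \<psi> (gs 0 a))"
  unfolding map_defect_def sum_atMost_ends[OF \<open>0 < n\<close>]
  using assms by (simp add: additive.add algebra_simps)

lemma fps_map1_single: 
  "fps_map1 (\<lambda>i. if i = 0 then g else (\<lambda>_. 0)) x $ n = g (x $ n)"
proof -
  have "fps_map1 (\<lambda>i. if i = 0 then g else (\<lambda>_. 0)) x $ n = (\<Sum>i\<le>n. if i = 0 then g (x $ n) else 0)"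
    unfolding fps_map1_nth by (rule sum.cong) auto
  then show ?thesis by simp
qed

lemma fps_map2_single: 
  "fps_map2 (\<lambda>i. if i = 0 then m else (\<lambda>_ _. 0)) x y $ n = (\<Sum>j\<le>n. m (x $ j) (y $ (n - j)))"
proof -
  have "fps_map2 (\<lambda>i. if i = 0 then m else (\<lambda>_ _. 0)) x y $ n
      = (\<Sum>i\<le>n. if i = 0 then \<Sum>j\<le>n. m (x $ j) (y $ (n - j)) else 0)"
    unfolding fps_map2_nth by (rule sum.cong) auto
  then show ?thesis by simp
qed

context asgder_triple
begin

section \<open>The constant deformation\<close>

abbreviation "\<mu>0 \<equiv> fps_map2 (\<lambda>i. if i = 0 then \<mu> else (\<lambda>_ _. 0))"
abbreviation "h0 \<equiv> fps_map1 (\<lambda>i. if i = 0 then h else (\<lambda>_. 0))"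
abbreviation "\<delta>0 \<equiv> fps_map1 (\<lambda>i. if i = 0 then \<delta> else (\<lambda>_. 0))"

lemma additive_series_const:
  assumes "Modules.additive g"
  shows "additive_series (\<lambda>i. if i = 0 then \<mu> else (\<lambda>_ _. 0)) (\<lambda>i. if i = 0 then h else (\<lambda>_. 0))
    (\<lambda>i. if i = 0 then g else (\<lambda>_. 0))"
  using assms mu_additive h_additive by (auto simp: additive_series_def additive_def)

text \<open>The associator vanishes on constants in every degree, hence on all series by the
  low-order principle; no manipulation of nested sums is required.\<close>

lemma const_mult_assoc: "\<mu>0 (\<mu>0 x y) z = \<mu>0 x (\<mu>0 y z)"
proof (rule fps_ext)
  fix n
  interpret additive_series "\<lambda>i. if i = 0 then \<mu> else (\<lambda>_ _. 0)" "\<lambda>i. if i = 0 then h else (\<lambda>_. 0)"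
    "\<lambda>i. if i = 0 then h else (\<lambda>_. 0)"
    by (rule additive_series_const[OF h_additive])
  have "associator_coeff (\<lambda>i. if i = 0 then \<mu> else (\<lambda>_ _. 0)) k a b c = 0" for k a b c
    unfolding associator_coeff_def by (rule sum.neutral) (auto simp: mult_assoc)
  from associator_nth[OF this order_refl, of x y z n] this
  show "\<mu>0 (\<mu>0 x y) z $ n = \<mu>0 x (\<mu>0 y z) $ n"
    by (simp add: associator_def)
qed

text \<open>Stated for a general \<open>g\<close> so as to cover both \<open>h\<close> and
  \<open>\<delta>\<close>.\<close>

lemma const_leibniz:
  assumes g: "Modules.additive g" and leibniz: "\<And>a b. g (\<mu> a b) = \<mu> (g a) b + \<mu> a (h b)"
  shows "fps_map1 (\<lambda>i. if i = 0 then g else (\<lambda>_. 0)) (\<mu>0 x y)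
    = \<mu>0 (fps_map1 (\<lambda>i. if i = 0 then g else (\<lambda>_. 0)) x) y + \<mu>0 x (h0 y)"
proof (rule fps_ext)
  fix n
  interpret additive_series "\<lambda>i. if i = 0 then \<mu> else (\<lambda>_ _. 0)" "\<lambda>i. if i = 0 then h else (\<lambda>_. 0)"
    "\<lambda>i. if i = 0 then g else (\<lambda>_. 0)"
    by (rule additive_series_const[OF g])
  have "leibniz_coeff (\<lambda>i. if i = 0 then \<mu> else (\<lambda>_ _. 0)) (\<lambda>i. if i = 0 then h else (\<lambda>_. 0))
      (\<lambda>i. if i = 0 then g else (\<lambda>_. 0)) k a b = 0" for k a b
    unfolding leibniz_coeff_def by (rule sum.neutral) (auto simp: leibniz additive.zero[OF g])
  from leibniz_nth[OF this order_refl, of x y n] this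
  show "fps_map1 (\<lambda>i. if i = 0 then g else (\<lambda>_. 0)) (\<mu>0 x y) $ n
      = (\<mu>0 (fps_map1 (\<lambda>i. if i = 0 then g else (\<lambda>_. 0)) x) y + \<mu>0 x (h0 y)) $ n"
    by (simp add: leibniz_def algebra_simps)
qed

end

locale asgder_deformation = asgder_triple scale \<mu> h \<delta>
  for scale :: "'k::comm_ring_1 \<Rightarrow> 'a::ab_group_add \<Rightarrow> 'a" and \<mu> h \<delta> +
  fixes ms :: "nat \<Rightarrow> 'a \<Rightarrow> 'a \<Rightarrow> 'a" and hs ds :: "nat \<Rightarrow> 'a \<Rightarrow> 'a"
  assumes ms_bilin: "bilin scale (ms i)" and hs_linear: "module_hom scale scale (hs i)"
    and ds_linear: "module_hom scale scale (ds i)"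
    and zeroth: "ms 0 = \<mu>" "hs 0 = h" "ds 0 = \<delta>"
    and deformed: "asgder_triple (fps_scale scale) (fps_map2 ms) (fps_map1 hs) (fps_map1 ds)"
begin

sublocale additive_series ms hs ds
  unfolding additive_series_def
  using bilin_additive[OF ms_bilin] module_hom_additive[OF hs_linear] module_hom_additive[OF ds_linear]
  by blast

sublocale const: additive_series "\<lambda>i. if i = 0 then \<mu> else (\<lambda>_ _. 0)" "\<lambda>i. if i = 0 then h else (\<lambda>_. 0)"
    "\<lambda>i. if i = 0 then \<delta> else (\<lambda>_. 0)"
  by (rule additive_series_const[OF d_additive])

lemmas M_assoc = asgder_triple.mult_assoc[OF deformed]
lemmas H_leibniz = asgder_triple.der[OF deformed]
lemmas D_leibniz = asgder_triple.gder[OF deformed]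
lemmas h0_leibniz = const_leibniz[OF h_additive der]
lemmas \<delta>0_leibniz = const_leibniz[OF d_additive gder]

context
  fixes \<phi> :: "nat \<Rightarrow> 'a \<Rightarrow> 'a"
  assumes \<phi>_linear: "\<And>i. module_hom scale scale (\<phi> i)" and \<phi>_0: "\<phi> 0 = id"
begin

section \<open>Errors of a candidate isomorphism onto the constant deformation\<close>

abbreviation "\<Phi> \<equiv> fps_map1 \<phi>"

lemma \<Phi>_linear: "fps_linear \<Phi>"
  by (rule fps_linear_map1) (rule module_hom_additive[OF \<phi>_linear])

lemmas \<Phi>_const = fps_map1_const[of \<phi>, OF module_hom_additive[OF \<phi>_linear]]
lemmas \<Phi>_additive = \<Phi>_linear[unfolded fps_linear_def, THEN conjunct1]
lemmas const_diff = const.MHD_diff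

definition mult_error where "mult_error x y = \<Phi> (M x y) - \<mu>0 (\<Phi> x) (\<Phi> y)"
definition h_error where "h_error x = \<Phi> (H x) - h0 (\<Phi> x)"
definition \<delta>_error where "\<delta>_error x = \<Phi> (D x) - \<delta>0 (\<Phi> x)"

lemma mult_error_linear: "fps_linear (mult_error x)" "fps_linear (\<lambda>x. mult_error x y)"
  unfolding mult_error_def
  by (rule fps_linear_diff fps_linear_compose[OF \<Phi>_linear] fps_linear_MHD
      fps_linear_compose[OF const.fps_linear_MHD(1) \<Phi>_linear]
      fps_linear_compose[OF const.fps_linear_MHD(2) \<Phi>_linear])+

lemma map_error_linear: "fps_linear h_error" "fps_linear \<delta>_error"
  unfolding h_error_def \<delta>_error_def
  by (rule fps_linear_diff fps_linear_compose[OF \<Phi>_linear] fps_linear_MHD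
      fps_linear_compose[OF const.fps_linear_MHD(3) \<Phi>_linear]
      fps_linear_compose[OF const.fps_linear_MHD(4) \<Phi>_linear])+

lemma error_const:
  "mult_error (fps_const a) (fps_const b) $ n = mult_defect \<mu> ms \<phi> n a b"
  "h_error (fps_const a) $ n = map_defect h hs \<phi> n a"
  "\<delta>_error (fps_const a) $ n = map_defect \<delta> ds \<phi> n a"
  by (simp_all add: mult_error_def h_error_def \<delta>_error_def mult_defect_def map_defect_def
      fps_map2_const_const[OF ms_additive(2,1)] fps_map1_const[OF hs_additive] fps_map1_const[OF ds_additive]
      \<Phi>_const fps_map1_single fps_map2_single fps_map1_nth)

text \<open>Each compares an axiom of the deformed structure, pushed forward by
  \<open>\<Phi>\<close>, with the same axiom of the constant structure. Errors take values in the
  constant structure, so the outer factors appear as \<open>\<Phi> x\<close>.\<close>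

lemma error_identities:
  "\<mu>0 (\<Phi> x) (mult_error y z) - mult_error (M x y) z + mult_error x (M y z) - \<mu>0 (mult_error x y) (\<Phi> z) = 0"
  "mult_error x (H y) + mult_error (H x) y - h0 (mult_error x y)
    + \<mu>0 (h_error x) (\<Phi> y) + \<mu>0 (\<Phi> x) (h_error y) - h_error (M x y) = 0"
  "mult_error (D x) y + mult_error x (H y) - \<delta>0 (mult_error x y)
    + \<mu>0 (\<delta>_error x) (\<Phi> y) + \<mu>0 (\<Phi> x) (h_error y) - \<delta>_error (M x y) = 0"
  by (simp_all add: mult_error_def h_error_def \<delta>_error_def const_diff const_mult_assoc h0_leibniz \<delta>0_leibniz
      M_assoc H_leibniz D_leibniz additive.add[OF \<Phi>_additive])

lemma error_nth:
  assumes "\<And>k a b. k < n \<Longrightarrow> mult_defect \<mu> ms \<phi> k a b = 0"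
    "\<And>k a. k < n \<Longrightarrow> map_defect h hs \<phi> k a = 0" "\<And>k a. k < n \<Longrightarrow> map_defect \<delta> ds \<phi> k a = 0"
    and "m \<le> n"
  shows "mult_error x y $ m = mult_defect \<mu> ms \<phi> m (x $ 0) (y $ 0)"
    "h_error x $ m = map_defect h hs \<phi> m (x $ 0)"
    "\<delta>_error x $ m = map_defect \<delta> ds \<phi> m (x $ 0)"
  using fps_bilinear_low_order[OF mult_error_linear, of n m x y]
    fps_linear_low_order[OF map_error_linear(1), of n m x] fps_linear_low_order[OF map_error_linear(2), of n m x]
    assms by (simp_all add: error_const)

text \<open>The coefficient at \<open>t^n\<close> of \<open>error_identities\<close> on constants;
  there \<open>\<Phi>\<close> acts on constant terms as the identity and the outer operations are
  the original ones.\<close>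

lemma defect_cocycle:
  assumes low: "\<And>k a b. k < n \<Longrightarrow> mult_defect \<mu> ms \<phi> k a b = 0"
    "\<And>k a. k < n \<Longrightarrow> map_defect h hs \<phi> k a = 0" "\<And>k a. k < n \<Longrightarrow> map_defect \<delta> ds \<phi> k a = 0"
  shows "(nary2 (mult_defect \<mu> ms \<phi> n), nary1 (map_defect h hs \<phi> n), nary1 (map_defect \<delta> ds \<phi> n))
    \<in> cocycles scale \<mu> h \<delta> 2"
proof -
  note slots = ms_bilin[unfolded bilin_def, THEN conjunct1, rule_format]
    ms_bilin[unfolded bilin_def, THEN conjunct2, rule_format]
    mult_bilin[unfolded bilin_def, THEN conjunct1, rule_format]
    mult_bilin[unfolded bilin_def, THEN conjunct2, rule_format]
  have lin: "bilin scale (mult_defect \<mu> ms \<phi> n)" "module_hom scale scale (map_defect h hs \<phi> n)"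
    "module_hom scale scale (map_defect \<delta> ds \<phi> n)"
    unfolding mult_defect_def map_defect_def bilin_def
    by (rule allI conjI linear_diff linear_sum linear_compose[OF \<phi>_linear] slots(1,2) hs_linear ds_linear
      linear_compose[OF slots(3) \<phi>_linear] linear_compose[OF slots(4) \<phi>_linear]
      linear_compose[OF der_linear \<phi>_linear] linear_compose[OF gder_linear \<phi>_linear])+
  have e: "mult_error x y $ k = 0" "h_error x $ k = 0" "\<delta>_error x $ k = 0" if "k < n" for x y k
    using error_nth[OF low, where m = k] low that by simp_all
  have zero: "\<Phi> x $ 0 = x $ 0" "H x $ 0 = h (x $ 0)" "D x $ 0 = \<delta> (x $ 0)" for x
    by (simp_all add: fps_map1_nth \<phi>_0 zeroth)
  note nth = error_nth[OF low order_refl]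
    fps_map2_high_order_left[OF const.ms_additive(2) e(1)] fps_map2_high_order_left[OF const.ms_additive(2) e(2)]
    fps_map2_high_order_left[OF const.ms_additive(2) e(3)] fps_map2_high_order_right[OF const.ms_additive(1) e(1)]
    fps_map2_high_order_right[OF const.ms_additive(1) e(2)]
  show ?thesis
    unfolding cocycles_2_iff[OF lin]
  proof (intro conjI allI)
    fix a b c
    note id = error_identities[of "fps_const a" "fps_const b", THEN arg_cong[of _ _ "\<lambda>x. x $ n"]]
    show "\<mu> a (mult_defect \<mu> ms \<phi> n b c) - mult_defect \<mu> ms \<phi> n (\<mu> a b) c + mult_defect \<mu> ms \<phi> n a (\<mu> b c)
        - \<mu> (mult_defect \<mu> ms \<phi> n a b) c = 0"
      using id(1)[of "fps_const c"] by (simp add: nth zero zeroth)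
    show "mult_defect \<mu> ms \<phi> n a (h b) + mult_defect \<mu> ms \<phi> n (h a) b - h (mult_defect \<mu> ms \<phi> n a b)
        + \<mu> (map_defect h hs \<phi> n a) b + \<mu> a (map_defect h hs \<phi> n b) - map_defect h hs \<phi> n (\<mu> a b) = 0"
      using id(2) by (simp add: nth zero zeroth fps_map1_single)
    show "mult_defect \<mu> ms \<phi> n (\<delta> a) b + mult_defect \<mu> ms \<phi> n a (h b) - \<delta> (mult_defect \<mu> ms \<phi> n a b)
        + \<mu> (map_defect \<delta> ds \<phi> n a) b + \<mu> a (map_defect h hs \<phi> n b) - map_defect \<delta> ds \<phi> n (\<mu> a b) = 0"
      using id(3) by (simp add: nth zero zeroth fps_map1_single)
  qed
qed

text \<open>Errors that vanish on constants in every degree vanish identically, and bijectivity is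
  automatic from \<open>\<phi> 0 = id\<close>.\<close>

lemma trivial_deformationI:
  assumes "\<And>k a b. mult_defect \<mu> ms \<phi> k a b = 0"
    "\<And>k a. map_defect h hs \<phi> k a = 0" "\<And>k a. map_defect \<delta> ds \<phi> k a = 0"
  shows "trivial_deformation scale \<mu> h \<delta> M H D"
proof -
  have "mult_error x y = 0" "h_error x = 0" "\<delta>_error x = 0" for x y
    using error_nth[OF assms order_refl] assms by (simp_all add: fps_eq_iff)
  moreover have "module_hom (fps_scale scale) (fps_scale scale) \<Phi>"
    using asgder_triple.axioms(1)[OF deformed] fps_map1_scale[of scale \<phi>, OF \<phi>_linear]
    by (simp add: module_hom_iff additive.add[OF \<Phi>_additive])
  moreover have "bij \<Phi>"
    by (rule bij_fps_map1[of \<phi>, OF module_hom_additive[OF \<phi>_linear] \<phi>_0])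
  ultimately have "asgder_iso (fps_scale scale) M H D \<mu>0 h0 \<delta>0 \<Phi>"
    by (simp add: asgder_iso_def mult_error_def h_error_def \<delta>_error_def)
  then show ?thesis
    unfolding trivial_deformation_def using \<phi>_linear \<phi>_0 by blast
qed

end

text \<open>Degree \<open>n\<close> is included: \<open>\<phi>\<close> intertwines modulo
  \<open>t^(n+1)\<close>.\<close>

definition intertwines_upto :: "nat \<Rightarrow> (nat \<Rightarrow> 'a \<Rightarrow> 'a) \<Rightarrow> bool" where
  "intertwines_upto n \<phi> \<longleftrightarrow> (\<forall>i. module_hom scale scale (\<phi> i)) \<and> \<phi> 0 = id \<and>
    (\<forall>k\<le>n. (\<forall>a b. mult_defect \<mu> ms \<phi> k a b = 0) \<and>
      (\<forall>a. map_defect h hs \<phi> k a = 0 \<and> map_defect \<delta> ds \<phi> k a = 0))"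

text \<open>The defect in degree \<open>Suc n\<close> is a 2-cocycle, hence the differential of some
  \<open>\<psi>\<close>, and adding \<open>\<psi>\<close> in that degree removes it. Keeping the
  lower coefficients makes the passage to the limit possible.\<close>

lemma intertwines_upto_extend:
  assumes H2: "trivial_group (cohomology scale \<mu> h \<delta> 2)" and \<phi>: "intertwines_upto n \<phi>"
  shows "\<exists>\<phi>'. intertwines_upto (Suc n) \<phi>' \<and> (\<forall>k\<le>n. \<phi>' k = \<phi> k)"
proof -
  let ?m = "mult_defect \<mu> ms \<phi>" and ?p = "map_defect h hs \<phi>" and ?q = "map_defect \<delta> ds \<phi>"
  have lin: "module_hom scale scale (\<phi> i)" and \<phi>0: "\<phi> 0 = id" for i
    using \<phi> by (auto simp: intertwines_upto_def)
  have low: "?m k a b = 0" "?p k a = 0" "?q k a = 0" if "k < Suc n" for k a b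
    using \<phi> that by (auto simp: intertwines_upto_def)
  have "(nary2 (?m (Suc n)), nary1 (?p (Suc n)), nary1 (?q (Suc n))) \<in> cocycles scale \<mu> h \<delta> 2"
    by (rule defect_cocycle[OF lin \<phi>0 low])
  then have "(nary2 (?m (Suc n)), nary1 (?p (Suc n)), nary1 (?q (Suc n))) \<in> coboundaries scale \<mu> h \<delta> 2"
    using H2 zero_in_coboundaries_2 trivial_cohomology_imp_coboundary by blast
  then obtain \<psi> where \<psi>: "module_hom scale scale \<psi>"
    and eq: "(nary2 (?m (Suc n)), nary1 (?p (Suc n)), nary1 (?q (Suc n)))
      = differential scale \<mu> h \<delta> 1 (nary1 \<psi>, 0, 0)"
    unfolding coboundaries_2_iff by blast
  from eq have defect: "?m (Suc n) = (\<lambda>a b. \<mu> a (\<psi> b) + \<mu> (\<psi> a) b - \<psi> (\<mu> a b))"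
    "?p (Suc n) = (\<lambda>a. h (\<psi> a) - \<psi> (h a))" "?q (Suc n) = (\<lambda>a. \<delta> (\<psi> a) - \<psi> (\<delta> a))"
    unfolding differential_1[OF \<psi>] prod.inject nary1_eq_iff nary2_eq_iff by blast+
  define \<phi>' where "\<phi>' = \<phi>(Suc n := \<lambda>a. \<phi> (Suc n) a + \<psi> a)"
  have old: "\<phi>' k = \<phi> k" if "k \<le> n" for k
    using that by (simp add: \<phi>'_def)
  have "mult_defect \<mu> ms \<phi>' k a b = 0 \<and> map_defect h hs \<phi>' k a = 0 \<and> map_defect \<delta> ds \<phi>' k a = 0"
    if "k \<le> Suc n" for k a b
  proof (cases "k \<le> n")
    case True
    then have "mult_defect \<mu> ms \<phi>' k = ?m k" "map_defect h hs \<phi>' k = ?p k" "map_defect \<delta> ds \<phi>' k = ?q k"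
      by (auto intro!: mult_defect_cong map_defect_cong old)
    then show ?thesis using low True by simp
  next
    case False
    then have "k = Suc n" using that by simp
    then show ?thesis
      unfolding \<phi>'_def
      by (simp add: zeroth defect \<phi>0 h_additive d_additive mu_additive
          mult_defect_update[where \<mu> = \<mu> and \<phi> = \<phi>]
          map_defect_update[where g = h and \<phi> = \<phi>] map_defect_update[where g = \<delta> and \<phi> = \<phi>])
  qed
  moreover have "module_hom scale scale (\<phi>' i)" for i
    using lin linear_add[OF lin \<psi>] by (simp add: \<phi>'_def)
  ultimately have "intertwines_upto (Suc n) \<phi>'"
    using \<phi>0 by (simp add: intertwines_upto_def \<phi>'_def)
  then show ?thesis using old by blast
qed

lemma trivial_deformation_if_cohomology_trivial:
  assumes H2: "trivial_group (cohomology scale \<mu> h \<delta> 2)"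
  shows "trivial_deformation scale \<mu> h \<delta> M H D"
proof -
  \<comment> \<open>In degree 0 the two structures agree, so the identity starts the
    construction.\<close>
  have "intertwines_upto 0 (\<lambda>i. if i = 0 then id else (\<lambda>_. 0))"
    using module_axioms
    by (auto simp: intertwines_upto_def mult_defect_def map_defect_def zeroth module_hom_iff)
  then have "\<exists>f. \<forall>n. intertwines_upto n (f n) \<and> (\<forall>k\<le>n. f (Suc n) k = f n k)"
    using intertwines_upto_extend[OF H2]
    by (intro dependent_nat_choice[of intertwines_upto "\<lambda>n \<phi> \<phi>'. \<forall>k\<le>n. \<phi>' k = \<phi> k"]) blast+
  then obtain f where f: "intertwines_upto n (f n)" and step: "k \<le> n \<Longrightarrow> f (Suc n) k = f n k" for n k
    by blast
  \<comment> \<open>Coefficient \<open>k\<close> no longer changes from stage \<open>k\<close> on,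
    so the diagonal is the \<open>t\<close>-adic limit of the stages.\<close>
  define \<phi> where "\<phi> k = f k k" for k
  have agree: "f n k = \<phi> k" if "k \<le> n" for n k
    using that by (induction rule: dec_induct) (simp_all add: \<phi>_def step)
  have "mult_defect \<mu> ms \<phi> n = mult_defect \<mu> ms (f n) n" "map_defect h hs \<phi> n = map_defect h hs (f n) n"
    "map_defect \<delta> ds \<phi> n = map_defect \<delta> ds (f n) n" for n
    by (auto intro!: mult_defect_cong map_defect_cong simp: agree)
  then show ?thesis
    using f by (intro trivial_deformationI[of \<phi>]) (auto simp: intertwines_upto_def \<phi>_def)
qed

end

context asgder_triple
begin

section \<open>Rigidity, and the obstruction class\<close>

lemma formal_deformation_trivial:
  assumes "trivial_group (cohomology scale \<mu> h \<delta> 2)" and "formal_deformation scale \<mu> h \<delta> \<mu>t ht \<delta>t"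
  shows "trivial_deformation scale \<mu> h \<delta> \<mu>t ht \<delta>t"
proof -
  note formal = assms(2)[unfolded formal_deformation_def]
  from formal[THEN conjunct2] obtain ms hs ds where
    *: "(\<forall>i. bilin scale (ms i) \<and> module_hom scale scale (hs i) \<and> module_hom scale scale (ds i)) \<and>
      ms 0 = \<mu> \<and> hs 0 = h \<and> ds 0 = \<delta> \<and> \<mu>t = fps_map2 ms \<and> ht = fps_map1 hs \<and> \<delta>t = fps_map1 ds"
    by (elim exE)
  then have lin: "bilin scale (ms i)" "module_hom scale scale (hs i)" "module_hom scale scale (ds i)"
    and zeroth: "ms 0 = \<mu>" "hs 0 = h" "ds 0 = \<delta>"
    and t: "\<mu>t = fps_map2 ms" "ht = fps_map1 hs" "\<delta>t = fps_map1 ds" for i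
    by simp_all
  interpret asgder_deformation scale \<mu> h \<delta> ms hs ds
    by (intro asgder_deformation.intro asgder_triple_axioms asgder_deformation_axioms.intro
        lin zeroth formal[THEN conjunct1, unfolded t])
  show ?thesis
    unfolding t by (rule trivial_deformation_if_cohomology_trivial[OF assms(1)])
qed

lemma deformation_eqs_iff_differential:
  assumes "bilin scale (ms n)" "module_hom scale scale (hs n)" "module_hom scale scale (ds n)"
  shows "deformation_eqs \<mu> h \<delta> ms hs ds n \<longleftrightarrow>
    Ob ms hs ds n = differential scale \<mu> h \<delta> 2 (nary2 (ms n), nary1 (hs n), nary1 (ds n))"
  unfolding differential_2[OF assms] Ob_def prod.inject nary2_eq_iff nary3_eq_iff
  by (auto simp: deformation_eqs_def DE1_def DE2_def DE3_def fun_eq_iff)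

lemma linear_comp_slots:
  assumes "bilin scale m" "module_hom scale scale f"
  shows "module_hom scale scale (\<lambda>x. m (f x) b)" "module_hom scale scale (\<lambda>x. m a (f x))"
  using assms by (auto simp: bilin_def intro: linear_compose)

text \<open>The equations below \<open>n\<close> make the defects of the truncated series start in
  degree \<open>n\<close>, where the coefficient identities are the cocycle conditions.\<close>

lemma Ob_cocycle:
  assumes "2 \<le> n" and
    "\<forall>k\<in>{1..n - 1}. bilin scale (ms k) \<and> module_hom scale scale (hs k) \<and>
      module_hom scale scale (ds k) \<and> deformation_eqs \<mu> h \<delta> ms hs ds k"
  shows "Ob ms hs ds n \<in> cocycles scale \<mu> h \<delta> 3"
proof -
  \<comment> \<open>Cutting the series off at \<open>n\<close> removes the terms with index \<open>n\<close>, so that the coefficient at \<open>t\<^sup>n\<close>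
    of the associator and of the Leibniz defects is exactly the obstruction.\<close>
  define M where "M i = (if i = 0 then \<mu> else if i < n then ms i else (\<lambda>_ _. 0))" for i
  define H where "H i = (if i = 0 then h else if i < n then hs i else (\<lambda>_. 0))" for i
  define D where "D i = (if i = 0 then \<delta> else if i < n then ds i else (\<lambda>_. 0))" for i
  have hyp: "bilin scale (ms k)" "module_hom scale scale (hs k)" "module_hom scale scale (ds k)"
    "deformation_eqs \<mu> h \<delta> ms hs ds k" if "0 < k" "k < n" for k
    using assms(2) that by auto
  have zero: "module_hom scale scale (\<lambda>_. 0)"
    by (simp add: module_hom_iff module_axioms)
  have lin: "bilin scale (M i)" "module_hom scale scale (H i)" "module_hom scale scale (D i)" for i
    using hyp[of i] zero mult_bilin der_linear gder_linear
    by (auto simp: M_def H_def D_def bilin_def)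
  interpret d: additive_series M H D
    unfolding additive_series_def using lin bilin_additive module_hom_additive by blast
  interpret h: additive_series M H H
    using d.additive_series_axioms by (simp add: additive_series_def)
  have Ob: "Ob1 M k = Ob1 ms k" "Ob2 M H k = Ob2 ms hs k" "Ob3 M H D k = Ob3 ms hs ds k" if "k \<le> n" for k
    by (rule Ob_cong; use that in \<open>simp add: M_def H_def D_def\<close>)+
  have zeroth: "M 0 = \<mu>" "H 0 = h" "D 0 = \<delta>"
    by (simp_all add: M_def H_def D_def)
  have low: "associator_coeff M k a b c = 0" "leibniz_coeff M H H k a b = 0" "leibniz_coeff M H D k a b = 0"
    if "k < n" for k a b c
  proof -
    \<comment> \<open>Degree 0 is covered by the axioms of the triple, the higher degrees by the
      deformation equations.\<close>
    consider "k = 0" | "0 < k" by blast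
    then have "associator_coeff M k a b c = 0 \<and> leibniz_coeff M H H k a b = 0 \<and> leibniz_coeff M H D k a b = 0"
    proof cases
      case 1
      then show ?thesis
        by (simp add: associator_coeff_def leibniz_coeff_def zeroth mult_assoc der gder)
    next
      case 2
      have top: "M k = ms k" "H k = hs k" "D k = ds k" using 2 that by (simp_all add: M_def H_def D_def)
      have "DE1 \<mu> ms k" "DE2 \<mu> h ms hs k" "DE3 \<mu> h \<delta> ms hs ds k"
        using hyp(4)[OF 2 that] by (simp_all add: deformation_eqs_def)
      then show ?thesis
        using Ob[OF less_imp_le[OF that]]
        by (simp add: associator_coeff_eq[OF 2] leibniz_coeff_eq[OF 2] zeroth top DE1_def DE2_def DE3_def
            flip: Ob2_eq_Ob3)
    qed
    then show "associator_coeff M k a b c = 0" "leibniz_coeff M H H k a b = 0" "leibniz_coeff M H D k a b = 0"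
      by blast+
  qed
  have n: "0 < n" using assms(1) by simp
  have top: "M n = (\<lambda>_ _. 0)" "H n = (\<lambda>_. 0)" "D n = (\<lambda>_. 0)" using n by (simp_all add: M_def H_def D_def)
  have coeff: "associator_coeff M n = Ob1 ms n" "leibniz_coeff M H H n = Ob2 ms hs n"
    "leibniz_coeff M H D n = Ob3 ms hs ds n"
    using Ob[of n]
    by (simp_all add: fun_eq_iff associator_coeff_eq[OF n] leibniz_coeff_eq[OF n] zeroth top
        flip: Ob2_eq_Ob3)
  have slots: "module_hom scale scale (\<lambda>x. M i x b)" "module_hom scale scale (M i a)" for i a b
    using lin(1)[of i] by (auto simp: bilin_def)
  \<comment> \<open>Linearity is read off from the truncated series, whose members are linear at
    every index, whereas \<open>ms\<close> is controlled only strictly between 0 and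
    \<open>n\<close>.\<close>
  have lin1: "module_hom scale scale (\<lambda>a. Ob1 ms n a b c)" "module_hom scale scale (\<lambda>b. Ob1 ms n a b c)"
    "module_hom scale scale (\<lambda>c. Ob1 ms n a b c)" for a b c
    unfolding coeff(1)[symmetric] associator_coeff_def
    by (intro linear_sum linear_diff linear_comp_slots[OF lin(1)] slots)+
  have lin2: "bilin scale (Ob2 ms hs n)" "bilin scale (Ob3 ms hs ds n)"
    unfolding coeff(2,3)[symmetric] leibniz_coeff_def bilin_def
    by (intro allI conjI linear_sum linear_diff linear_comp_slots[OF lin(1)] slots lin
        linear_compose[OF lin(2)] linear_compose[OF lin(3)])+
  have "Ob ms hs ds n \<in> cochains scale 3"
    using nary3_in_Hom[OF lin1] lin2 by (simp add: Ob_def cochains_def nary2_in_Hom_iff)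
  moreover have "differential scale \<mu> h \<delta> 3 (Ob ms hs ds n) = 0"
    unfolding Ob_def
  proof (rule differential_3_eq_0[OF lin1 lin2])
    show "\<mu> a (Ob1 ms n b c d) - Ob1 ms n (\<mu> a b) c d + Ob1 ms n a (\<mu> b c) d - Ob1 ms n a b (\<mu> c d)
        + \<mu> (Ob1 ms n a b c) d = 0" for a b c d
      using d.associator_coeff_cocycle[of n a b c d] low by (simp add: coeff zeroth)
    show "\<mu> a (Ob2 ms hs n b c) - \<mu> (Ob2 ms hs n a b) c - Ob2 ms hs n (\<mu> a b) c + Ob2 ms hs n a (\<mu> b c)
        + h (Ob1 ms n a b c) - Ob1 ms n (h a) b c - Ob1 ms n a (h b) c - Ob1 ms n a b (h c) = 0" for a b c
      using leibniz_coeff_cocycle[OF h.additive_series_axioms, of n a b c] low by (simp add: coeff zeroth)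
    show "\<mu> a (Ob2 ms hs n b c) - \<mu> (Ob3 ms hs ds n a b) c - Ob3 ms hs ds n (\<mu> a b) c + Ob3 ms hs ds n a (\<mu> b c)
        + \<delta> (Ob1 ms n a b c) - Ob1 ms n (\<delta> a) b c - Ob1 ms n a (h b) c - Ob1 ms n a b (h c) = 0" for a b c
      using leibniz_coeff_cocycle[OF d.additive_series_axioms, of n a b c] low by (simp add: coeff zeroth)
  qed
  ultimately show ?thesis by (simp add: cocycles_def)
qed

text \<open>Changing the entries at \<open>n\<close> leaves \<open>Ob\<close> in degree
  \<open>n\<close> unchanged, so the equations say that this fixed cochain is the differential of
  the new triple.\<close>

lemma deformation_eqs_extension_iff:
  "(\<exists>m p q. bilin scale m \<and> module_hom scale scale p \<and> module_hom scale scale q \<and>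
      deformation_eqs \<mu> h \<delta> (ms(n := m)) (hs(n := p)) (ds(n := q)) n) \<longleftrightarrow>
    cohomology_class scale \<mu> h \<delta> 3 (Ob ms hs ds n) = \<one>\<^bsub>cohomology scale \<mu> h \<delta> 3\<^esub>"
proof -
  have "Ob (ms(n := m)) (hs(n := p)) (ds(n := q)) n = Ob ms hs ds n" for m p q
    unfolding Ob_def by (intro prod.inject[THEN iffD2] conjI arg_cong[of _ _ nary3] arg_cong[of _ _ nary2] Ob_cong) auto
  then have "deformation_eqs \<mu> h \<delta> (ms(n := m)) (hs(n := p)) (ds(n := q)) n \<longleftrightarrow>
      Ob ms hs ds n = differential scale \<mu> h \<delta> 2 (nary2 m, nary1 p, nary1 q)"
    if "bilin scale m" "module_hom scale scale p" "module_hom scale scale q" for m p q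
    using deformation_eqs_iff_differential[of "ms(n := m)" n "hs(n := p)" "ds(n := q)"] that by simp
  then show ?thesis
    unfolding cohomology_class_eq_one_iff coboundaries_3_iff by metis
qed

end

theorem theorem0p7:
  fixes scale :: "'k::field_char_0 \<Rightarrow> 'a::ab_group_add \<Rightarrow> 'a"
    and \<mu> :: "'a \<Rightarrow> 'a \<Rightarrow> 'a" and h \<delta> :: "'a \<Rightarrow> 'a"
  assumes "asgder_triple scale \<mu> h \<delta>"
  shows "((\<forall>\<mu>1 h1 \<delta>1.
             bilin scale \<mu>1 \<and> module_hom scale scale h1 \<and> module_hom scale scale \<delta>1 \<longrightarrow>
             (infinitesimal_deformation scale \<mu> h \<delta> \<mu>1 h1 \<delta>1 \<longleftrightarrow>
              (nary2 \<mu>1, nary1 h1, nary1 \<delta>1) \<in> cocycles scale \<mu> h \<delta> 2)) \<and>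
          (trivial_group (cohomology scale \<mu> h \<delta> 2) \<longrightarrow>
             (\<forall>\<mu>t ht \<delta>t. formal_deformation scale \<mu> h \<delta> \<mu>t ht \<delta>t \<longrightarrow>
                trivial_deformation scale \<mu> h \<delta> \<mu>t ht \<delta>t))) \<and>
         (\<forall>n \<mu>s hs \<delta>s.
             2 \<le> n \<and>
             (\<forall>k\<in>{1..n - 1}.
                bilin scale (\<mu>s k) \<and> module_hom scale scale (hs k) \<and> module_hom scale scale (\<delta>s k) \<and>
                deformation_eqs \<mu> h \<delta> \<mu>s hs \<delta>s k) \<longrightarrow>
             Ob \<mu>s hs \<delta>s n \<in> cocycles scale \<mu> h \<delta> 3 \<and>
             ((\<exists>\<mu>n hn \<delta>n.
                 bilin scale \<mu>n \<and> module_hom scale scale hn \<and> module_hom scale scale \<delta>n \<and>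
                 deformation_eqs \<mu> h \<delta> (\<mu>s(n := \<mu>n)) (hs(n := hn)) (\<delta>s(n := \<delta>n)) n) \<longleftrightarrow>
              cohomology_class scale \<mu> h \<delta> 3 (Ob \<mu>s hs \<delta>s n) = \<one>\<^bsub>cohomology scale \<mu> h \<delta> 3\<^esub>) \<and>
             (trivial_group (cohomology scale \<mu> h \<delta> 3) \<longrightarrow>
              cohomology_class scale \<mu> h \<delta> 3 (Ob \<mu>s hs \<delta>s n) = \<one>\<^bsub>cohomology scale \<mu> h \<delta> 3\<^esub>))"
proof -
  interpret asgder_triple scale \<mu> h \<delta> by fact
  have "Ob \<mu>s hs \<delta>s n \<in> cocycles scale \<mu> h \<delta> 3 \<and>
      ((\<exists>\<mu>n hn \<delta>n.
         bilin scale \<mu>n \<and> module_hom scale scale hn \<and> module_hom scale scale \<delta>n \<and>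
         deformation_eqs \<mu> h \<delta> (\<mu>s(n := \<mu>n)) (hs(n := hn)) (\<delta>s(n := \<delta>n)) n) \<longleftrightarrow>
      cohomology_class scale \<mu> h \<delta> 3 (Ob \<mu>s hs \<delta>s n) = \<one>\<^bsub>cohomology scale \<mu> h \<delta> 3\<^esub>) \<and>
      (trivial_group (cohomology scale \<mu> h \<delta> 3) \<longrightarrow>
       cohomology_class scale \<mu> h \<delta> 3 (Ob \<mu>s hs \<delta>s n) = \<one>\<^bsub>cohomology scale \<mu> h \<delta> 3\<^esub>)"
    if "2 \<le> n \<and> (\<forall>k\<in>{1..n - 1}.
      bilin scale (\<mu>s k) \<and> module_hom scale scale (hs k) \<and> module_hom scale scale (\<delta>s k) \<and>
      deformation_eqs \<mu> h \<delta> \<mu>s hs \<delta>s k)" for n \<mu>s hs \<delta>s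
  proof -
    have "Ob \<mu>s hs \<delta>s n \<in> cocycles scale \<mu> h \<delta> 3"
      using that Ob_cocycle by blast
    then show ?thesis
      using deformation_eqs_extension_iff cohomology_class_eq_one_iff zero_in_coboundaries_3
        trivial_cohomology_imp_coboundary by blast
  qed
  then show ?thesis
    using infinitesimal_deformation_iff_cocycle formal_deformation_trivial by blast
qed

end
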